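(* The sequence of random variables $\frac{f_0(T_n)}{\log n}$ satisfies a large deviation principle on $\mathbb{R}$ with speed $\log n$ and good rate function $$I(x)=\begin{cases}+\infty, & x<0,\\[1mm] x\log\!\big(\tfrac x2\big)+x\,\operatorname{arsinh}(2x)-x-\tfrac12\sqrt{1+4x^2}+\tfrac32, & x\ge0,\end{cases}$$ with the convention $0\log 0=0$.
   Context: Let $T\subset\mathbb{R}^2$ be the triangle with vertices $(0,0)$, $\mathbf{v}_1=(1,0)$, $\mathbf{v}_2=(0,1)$. For $n\ge 0$ let $\mathbf{X}_1,\dots,\mathbf{X}_n$ be independent uniformly distributed random points in $T$ and $T_n:=\operatorname{conv}\{\mathbf{v}_1,\mathbf{v}_2,\mathbf{X}_1,\dots,\mathbf{X}_n\}$. $f_0(T_n)$ is the number of vertices of $T_n$ (including $\mathbf{v}_1,\mathbf{v}_2$). (The sequence is considered for $n\ge2$.) A sequence of random variables $X_n$ satisfies a large deviation principle on $\mathbb{R}$ with speed $s_n$ and good rate function $I:\mathbb{R}\to[0,+\infty]$ if $s_n\ge0$ with $s_n\to\infty$; $I$ is lower semicontinuous and has compact level sets $\{x\in\mathbb{R}:I(x)\le c\}$ for every $c\ge0$; and for every Borel set $B\subseteq\mathbb{R}$, $$-\inf_{x\in\operatorname{int}(B)}I(x)\le\liminf_{n\to\infty}\frac1{s_n}\log\mathbb{P}(X_n\in B)\le\limsup_{n\to\infty}\frac1{s_n}\log\mathbb{P}(X_n\in B)\le-\inf_{x\in\operatorname{cl}(B)}I(x).$$ *)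

theory Defs
  imports "HOL-Probability.Probability"
begin

definition unit_triangle :: "(real \<times> real) set" where
  "unit_triangle = convex hull {(0, 0), (1, 0), (0, 1)}"

definition random_polygon :: "(nat \<Rightarrow> real \<times> real) \<Rightarrow> nat \<Rightarrow> (real \<times> real) set" where
  "random_polygon x n = convex hull ({(1, 0), (0, 1)} \<union> x ` {1..n})"

definition num_vertices :: "'a::real_vector set \<Rightarrow> nat" where
  "num_vertices P = card {v. v extreme_point_of P}"

(* The library's ln returns 0 at 0, whereas the probabilities in a large deviation
   principle need log 0 = -\<infinity>. *)
definition eln :: "real \<Rightarrow> ereal" where
  "eln p = (if p = 0 then - \<infinity> else ereal (ln p))"

definition lower_semicontinuous :: "('a::topological_space \<Rightarrow> ereal) \<Rightarrow> bool" where
  "lower_semicontinuous I \<longleftrightarrow> (\<forall>x. I x \<le> Liminf (at x) I)"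

definition good_rate_function :: "(real \<Rightarrow> ereal) \<Rightarrow> bool" where
  "good_rate_function I \<longleftrightarrow>
     (\<forall>x. 0 \<le> I x) \<and> lower_semicontinuous I \<and>
     (\<forall>c\<ge>0. compact {x. I x \<le> ereal c})"

(* The n-th random variable lives on its own probability space M n, since a large deviation
   principle only involves the individual laws.  Infima over the empty set are \<infinity>. *)
definition satisfies_LDP ::
  "(nat \<Rightarrow> 'a measure) \<Rightarrow> (nat \<Rightarrow> 'a \<Rightarrow> real) \<Rightarrow> (nat \<Rightarrow> real) \<Rightarrow> (real \<Rightarrow> ereal) \<Rightarrow> bool" where
  "satisfies_LDP M Y s I \<longleftrightarrow>
     (\<forall>n. prob_space (M n) \<and> Y n \<in> borel_measurable (M n)) \<and>
     (\<forall>n. 0 \<le> s n) \<and> filterlim s at_top sequentially \<and>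
     good_rate_function I \<and>
     (\<forall>B \<in> sets borel.
        let L = (\<lambda>n. ereal (1 / s n) * eln (measure (M n) {\<omega> \<in> space (M n). Y n \<omega> \<in> B})) in
        - (INF x \<in> interior B. I x) \<le> liminf L \<and>
        liminf L \<le> limsup L \<and>
        limsup L \<le> - (INF x \<in> closure B. I x))"

(* The convention 0 log 0 = 0 holds automatically, as 0 * ln 0 = 0 in the library. *)
definition vertex_rate :: "real \<Rightarrow> ereal" where
  "vertex_rate x =
     (if x < 0 then \<infinity>
      else ereal (x * ln (x / 2) + x * arsinh (2 * x) - x - 1 / 2 * sqrt (1 + 4 * x\<^sup>2) + 3 / 2))"

end

theory Submission
  imports Defs "HOL-Real_Asymp.Real_Asymp"
begin

text \<open>
  The number of vertices is, apart from the two fixed ones, the number of steps of an explicit Markov chain.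
  Walk along the boundary of the polygon from the vertex (1,0). The next vertex is the random point p that is
  seen from (1,0) under the smallest angle. The further vertices lie in the cap of p, a triangle with
  base from p to (0,1), and the points in it are again independent and uniform. Since the problem is
  invariant under affine maps, it has reproduced itself with fewer points. In coordinates adapted to (1,0)
  the law of the number m of remaining points is a Beta integral, and n points become m < n points with
  probability 2 (n - m) / (n (n + 1)). The geometric step is \<open>num_vertices_split\<close>, its probabilistic form
  \<open>nn_integral_first_vertex_term\<close> and \<open>vertex_gf_eq\<close>.

  The generating function G of the number of random vertices therefore satisfies
  n (n + 1) G(n) = 2 z (sum of (n - m) G(m) over m < n). Comparison with sequences that grow like n^b shows that
  G(n) = n^(a + o(1)) with (a + 1) (a + 2) = 2 z, that is a = (sqrt(1 + 8 z) - 3) / 2 (\<open>chain_gf_growth\<close>). So with z = exp \<theta>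
  the cumulant generating functions, divided by log n, converge to (sqrt(1 + 8 exp \<theta>) - 3) / 2, which is
  differentiable in \<theta> and whose derivative takes every positive value. The argument of Gartner and Ellis
  now applies: the upper bound is Chernoff's inequality on half lines, the lower bound comes from exponential tilting
  (\<open>local_lower_bound\<close>), and the Legendre transform of the limit is the stated rate function (\<open>rate_eq_tilt\<close>).
\<close>

section \<open>The first vertex of the chain\<close>

lemma extreme_point_of_finite_convex_hull_iff:
  fixes F :: "'a::euclidean_space set"
  assumes "finite F"
  shows "v extreme_point_of (convex hull F) \<longleftrightarrow> v \<in> F \<and> v \<notin> convex hull (F - {v})"
proof
  assume v: "v extreme_point_of (convex hull F)"
  have "v \<in> F" using v by (rule extreme_point_of_convex_hull)
  moreover have "v \<notin> convex hull (F - {v})"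
  proof
    assume "v \<in> convex hull (F - {v})"
    then have "v extreme_point_of (convex hull (F - {v}))"
      using v hull_mono[of "F - {v}" F convex] by (auto simp: extreme_point_of_def)
    then have "v \<in> F - {v}" by (rule extreme_point_of_convex_hull)
    then show False by simp
  qed
  ultimately show "v \<in> F \<and> v \<notin> convex hull (F - {v})" by simp
next
  assume v: "v \<in> F \<and> v \<notin> convex hull (F - {v})"
  then have "v extreme_point_of (convex hull (insert v (F - {v})))"
    using assms by (intro extreme_point_of_convex_hull_insert) auto
  then show "v extreme_point_of (convex hull F)" using v by (simp add: insert_absorb)
qed

text \<open>Affine invariance is what makes the recursion close up: the part of the polygon that is cut off
  behind its first vertex lives in a smaller triangle, which an affine map carries back to the
  standard one.\<close>

lemma num_vertices_affine_image:
  fixes f :: "'a::real_vector \<Rightarrow> 'a"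
  assumes "linear f" "inj f"
  shows "num_vertices ((\<lambda>x. a + f x) ` K) = num_vertices K"
proof -
  have *: "(\<lambda>x. a + f x) ` K = (\<lambda>x. a + x) ` (f ` K)" by (simp add: image_image)
  have seg: "f x \<in> open_segment (f y) (f z) \<longleftrightarrow> x \<in> open_segment y z" for x y z
    using open_segment_linear_image[OF assms, of y z] assms(2) by (auto simp: inj_image_mem_iff)
  have "{v. v extreme_point_of (f ` K)} = f ` {v. v extreme_point_of K}"
    by (auto simp: extreme_point_of_def seg inj_image_mem_iff[OF assms(2)])
  then have "{v. v extreme_point_of ((\<lambda>x. a + f x) ` K)}
      = (\<lambda>x. a + x) ` f ` {v. v extreme_point_of K}"
    unfolding * extreme_points_of_translation by simp
  moreover have "inj_on (\<lambda>x. a + x) X" for X by simp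
  ultimately show ?thesis
    unfolding num_vertices_def
    by (simp add: card_image inj_on_subset[OF assms(2)])
qed

text \<open>Working in the open triangle excludes the null event of points on the boundary, where slopes may
  be 0 or 1 and points may coincide with the two fixed vertices.\<close>

definition open_triangle :: "(real \<times> real) set" where
  "open_triangle = {p. 0 < fst p \<and> 0 < snd p \<and> fst p + snd p < 1}"

text \<open>The ordinate at which the line from (1,0) through the point meets the vertical axis. It orders the
  points by the angle under which they are seen from (1,0).\<close>

definition slope :: "real \<times> real \<Rightarrow> real" where
  "slope p = snd p / (1 - fst p)"

text \<open>The triangle with corners p, (0,1) and (0, slope p). Once p is known to be the point of least slope,
  the points outside this triangle lie in the triangle with corners (1,0), p, (0,1) and cannot be
  vertices.\<close>

definition cap :: "real \<times> real \<Rightarrow> (real \<times> real) set" where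
  "cap p = {q. 0 \<le> fst q \<and> slope p * (1 - fst q) \<le> snd q
             \<and> fst q * (1 - snd p) \<le> fst p * (1 - snd q)}"

text \<open>Adding the apex (1,0) destroys no vertex. The point (0,1) survives because it alone has the greatest
  height, and p survives because all points lie on one side of the line from the apex through p and only these two lie
  on it. Any other point v of the cap lies beyond the segment from p to (0,1)
  as seen from the apex: were v on a segment from the apex to a point k of the hull of the other points,
  then v would already lie between k and the place where the segment from the apex to v crosses the
  segment from p to (0,1), and both of these belong to that hull.\<close>

lemma extreme_points_insert_apex:
  assumes p: "p \<in> open_triangle" and fin: "finite S"
    and S: "S \<subseteq> open_triangle" "S \<subseteq> cap p" "\<And>q. q \<in> S \<Longrightarrow> slope p * (1 - fst q) < snd q"
  shows "{v. v extreme_point_of (convex hull (insert (1, 0) ({p, (0, 1)} \<union> S)))}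
       = insert (1, 0) {v. v extreme_point_of (convex hull ({p, (0, 1)} \<union> S))}" (is "?L = ?R")
proof -
  define F where "F = {p, (0, 1)} \<union> S"
  define A where "A = ((1, 0)::real \<times> real)"
  define u where "u = slope p"
  have finF: "finite F" using fin by (simp add: F_def)
  have p': "0 < fst p" "0 < snd p" "fst p + snd p < 1" using p by (auto simp: open_triangle_def)
  have u: "u * (1 - fst p) = snd p" "0 < u" "u < 1"
    using p' by (auto simp: u_def slope_def field_simps)
  have S': "0 < fst q" "0 < snd q" "fst q + snd q < 1" "u * (1 - fst q) < snd q"
     "fst q * (1 - snd p) \<le> fst p * (1 - snd q)" if "q \<in> S" for q
    using S that by (auto simp: open_triangle_def cap_def u_def)
  have hull_in: "convex hull X \<subseteq> C" if "X \<subseteq> C" "convex C" for X C :: "(real \<times> real) set"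
    using that by (simp add: hull_minimal)
  have half: "convex {q::real\<times>real. c < a * fst q + b * snd q}" for a b c :: real
    using convex_halfspace_gt[of c "(a,b)"] by (simp add: inner_prod_def)
  have F1: "fst q < 1" if "q \<in> F" for q
    using that S'(2,3)[of q] p' unfolding F_def by fastforce
  have conv1: "fst q < 1" if "q \<in> convex hull F" for q
  proof -
    have "F \<subseteq> {q. -1 < (-1) * fst q + 0 * snd q}" using F1 by auto
    from hull_in[OF this half] that show ?thesis by auto
  qed
  have A_notin: "A \<notin> convex hull F" using conv1 by (force simp: A_def)
  have A_ext: "A extreme_point_of (convex hull (insert A F))"
    by (rule extreme_point_of_convex_hull_insert[OF finF A_notin])
  have iff: "v extreme_point_of (convex hull (insert A F)) \<longleftrightarrow> v extreme_point_of (convex hull F)"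
    if "v \<noteq> A" for v
  proof -
    have mono: "convex hull (F - {v}) \<subseteq> convex hull (insert A F - {v})"
      by (rule hull_mono) auto
    have "v \<in> convex hull (F - {v})" if vF: "v \<in> F" and v: "v \<in> convex hull (insert A F - {v})"
    proof (rule ccontr)
      assume contra: "v \<notin> convex hull (F - {v})"
      have ne: "F - {v} \<noteq> {}"
      proof -
        have "p \<noteq> (0,1)" using p' by auto
        then show ?thesis unfolding F_def by auto
      qed
      have "insert A F - {v} = insert A (F - {v})" using \<open>v \<noteq> A\<close> by auto
      with v obtain a t k where at: "0 \<le> a" "0 \<le> t" "a + t = 1" "k \<in> convex hull (F - {v})"
        and vk: "v = a *\<^sub>R A + t *\<^sub>R k"
        using convex_hull_insert[OF ne, of A] by auto
      have t: "0 < t" "t < 1"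
      proof -
        show "0 < t" using at vk \<open>v \<noteq> A\<close> by (cases "t = 0") auto
        have "t \<noteq> 1" using at vk contra by auto
        with at show "t < 1" by simp
      qed
      have k: "k \<in> convex hull F" using at(4) hull_mono[of "F - {v}" F convex] by auto
      have v1: "fst v = 1 - t + t * fst k" and v2: "snd v = t * snd k"
        using vk at(3) by (auto simp: A_def)
      consider "v = p" | "v = (0,1)" | "v \<in> S" "v \<noteq> p" "v \<noteq> (0,1)"
        using vF by (auto simp: F_def)
      then show False
      proof cases
        case 1
        have "F - {v} \<subseteq> {q. u < u * fst q + 1 * snd q}"
          using S' u 1 by (auto simp: F_def algebra_simps)
        from hull_in[OF this half] at(4) have "u < u * fst k + 1 * snd k" by blast
        then have "t * u < t * (u * fst k + snd k)" using t by simp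
        moreover have "u * fst v + snd v = u" using 1 u by (simp add: algebra_simps)
        ultimately show False using v1 v2 by (simp add: algebra_simps)
      next
        case 2
        have "F - {v} \<subseteq> {q. -1 < 0 * fst q + (-1) * snd q}"
          using S' p' 2 by (fastforce simp: F_def)
        from hull_in[OF this half] at(4) have "snd k < 1" by auto
        then have "t * snd k < 1" using t 2 v2 by (smt (verit) mult_le_cancel_left1 snd_conv)
        then show False using v2 2 by simp
      next
        case 3
        note Sv = S'[OF \<open>v \<in> S\<close>]
        \<comment> \<open>LA and Lv measure on which side of the line through p and (0,1) the apex A and v lie; their ratio
          gives the point w where the segment from A to v meets the segment from p to (0,1).\<close>
        define LA where "LA = 1 - snd p - fst p"
        define Lv where "Lv = fst p * (1 - snd v) - fst v * (1 - snd p)"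
        define s where "s = LA / (LA + Lv)"
        have LA: "0 < LA" and Lv: "0 \<le> Lv" using p' Sv by (auto simp: LA_def Lv_def)
        have s: "0 < s" "s \<le> 1" "s * (LA + Lv) = LA" using LA Lv by (auto simp: s_def)
        define w where "w = (1 - s) *\<^sub>R A + s *\<^sub>R v"
        define c where "c = fst w / fst p"
        have w1: "fst w = 1 - s + s * fst v" and w2: "snd w = s * snd v"
          by (auto simp: w_def A_def)
        have line: "fst w * (1 - snd p) = fst p * (1 - snd w)"
          using s(3) unfolding w1 w2 LA_def Lv_def by (simp add: algebra_simps)
        have c0: "0 \<le> c" using w1 s p' Sv by (auto simp: c_def)
        have cp: "c * fst p = fst w" using p' by (simp add: c_def)
        have cs: "snd w = c * snd p + (1 - c)"
        proof -
          have "fst p * snd w = fst p - fst w * (1 - snd p)" using line by (simp add: algebra_simps)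
          also have "\<dots> = fst p * (c * snd p + (1 - c))" unfolding cp[symmetric] by (simp add: algebra_simps)
          finally show ?thesis using p' by simp
        qed
        have "c \<le> 1"
        proof -
          have "s * (u * (1 - fst v)) \<le> s * snd v" using Sv s by simp
          then have "u * (1 - fst w) \<le> snd w" unfolding w1 w2 by (simp add: algebra_simps)
          then have "u * (1 - c * fst p) \<le> c * snd p + (1 - c)" using cp cs by simp
          then have "u * (1 - c) + c * (u * (1 - fst p)) \<le> c * snd p + (1 - c)" by (simp add: algebra_simps)
          then have "u * (1 - c) \<le> 1 * (1 - c)" using u by simp
          then have "0 \<le> (1 - u) * (1 - c)" by (simp add: algebra_simps)
          then show ?thesis using u(3) by (simp add: zero_le_mult_iff)
        qed
        have w: "w = c *\<^sub>R p + (1 - c) *\<^sub>R (0, 1)"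
          using cp cs by (auto simp: prod_eq_iff)
        have "p \<in> convex hull (F - {v})" "(0, 1) \<in> convex hull (F - {v})"
          using 3 by (auto simp: F_def intro!: hull_inc)
        then have wF: "w \<in> convex hull (F - {v})"
          unfolding w using c0 \<open>c \<le> 1\<close>
          by (intro convexD[OF convex_convex_hull]) auto
        have "t * s \<le> t * 1" using t s by (intro mult_left_mono) auto
        then have ts: "0 < 1 - t * s" using t by linarith
        have "(1 - t * s) *\<^sub>R v = (1 - t) *\<^sub>R w + (t * (1 - s)) *\<^sub>R k"
        proof -
          have "(1 - t) *\<^sub>R A = v - t *\<^sub>R k" unfolding vk at(3)[symmetric] by simp
          then have "(1 - t) *\<^sub>R w = (1 - s) *\<^sub>R (v - t *\<^sub>R k) + ((1 - t) * s) *\<^sub>R v"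
            unfolding w_def by (metis mult.commute scaleR_add_right scaleR_scaleR)
          then show ?thesis by (simp add: algebra_simps)
        qed
        then have "(1 / (1 - t * s)) *\<^sub>R (1 - t * s) *\<^sub>R v
            = (1 / (1 - t * s)) *\<^sub>R ((1 - t) *\<^sub>R w + (t * (1 - s)) *\<^sub>R k)" by simp
        then have "v = ((1 - t) / (1 - t * s)) *\<^sub>R w + (t * (1 - s) / (1 - t * s)) *\<^sub>R k"
          using ts by (simp add: scaleR_add_right)
        moreover have "\<dots> \<in> convex hull (F - {v})"
        proof (rule convexD[OF convex_convex_hull wF at(4)])
          have "(1 - t) + t * (1 - s) = 1 - t * s" by (simp add: algebra_simps)
          then show "(1 - t) / (1 - t * s) + t * (1 - s) / (1 - t * s) = 1"
            using ts by (metis add_divide_distrib divide_self less_irrefl)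
        qed (use t s ts in auto)
        ultimately show False using contra by simp
      qed
    qed
    then have "v \<in> F \<and> v \<notin> convex hull (insert A F - {v})
        \<longleftrightarrow> v \<in> F \<and> v \<notin> convex hull (F - {v})" using mono by auto
    then show ?thesis
      using \<open>v \<noteq> A\<close>
        extreme_point_of_finite_convex_hull_iff[OF finF, of v]
        extreme_point_of_finite_convex_hull_iff[OF finite.insertI[OF finF], of v A] by simp
  qed
  have "v \<in> {v. v extreme_point_of (convex hull (insert A F))}
      \<longleftrightarrow> v \<in> insert A {v. v extreme_point_of (convex hull F)}" for v
    using A_ext iff[of v] by (cases "v = A") simp_all
  then have "{v. v extreme_point_of (convex hull (insert A F))}
      = insert A {v. v extreme_point_of (convex hull F)}" by (rule set_eqI)
  then show ?thesis unfolding F_def A_def .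
qed

text \<open>One step along the boundary starting at (1,0): the next vertex is the point p of least slope, and what
  remains is the same problem for the base from p to (0,1) and the points in the cap of p.\<close>

lemma num_vertices_split:
  assumes p: "p \<in> open_triangle" and fin: "finite S" and S: "S \<subseteq> open_triangle"
    and lt: "\<And>q. q \<in> S \<Longrightarrow> slope p * (1 - fst q) < snd q"
  shows "num_vertices (convex hull ({(1, 0), (0, 1)} \<union> insert p S))
       = Suc (num_vertices (convex hull ({p, (0, 1)} \<union> (S \<inter> cap p))))"
proof -
  define F where "F = {p, (0, 1)} \<union> (S \<inter> cap p)"
  have p': "0 < fst p" "0 < snd p" "fst p + snd p < 1" using p by (auto simp: open_triangle_def)
  have "q \<in> convex hull (insert (1, 0) F)" if q: "q \<in> S - cap p" for q
  proof -
    define b where "b = (1 - fst q - snd q) / (1 - fst p - snd p)"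
    have q': "0 < fst q" "0 < snd q" "fst q + snd q < 1"
       "slope p * (1 - fst q) < snd q" "fst q * (1 - snd p) > fst p * (1 - snd q)"
      using q S lt[of q] by (auto simp: open_triangle_def cap_def)
    have b: "b * (1 - fst p - snd p) = 1 - fst q - snd q" "0 \<le> b"
      using p' q' by (auto simp: b_def)
    have "0 \<le> fst q - b * fst p"
    proof -
      have "(fst q - b * fst p) * (1 - fst p - snd p)
          = fst q * (1 - snd p) - fst p * (1 - snd q)"
        using arg_cong[OF b(1), of "\<lambda>x. fst p * x"] by (simp add: algebra_simps)
      then show ?thesis using p' q' by (smt (verit) mult_nonneg_nonpos zero_less_mult_iff)
    qed
    moreover have "0 \<le> snd q - b * snd p"
    proof -
      have "snd p * (1 - fst q) < snd q * (1 - fst p)"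
        using q'(4) p' by (simp add: slope_def field_simps)
      moreover have "(snd q - b * snd p) * (1 - fst p - snd p)
          = snd q * (1 - fst p) - snd p * (1 - fst q)"
        using arg_cong[OF b(1), of "\<lambda>x. snd p * x"] by (simp add: algebra_simps)
      ultimately show ?thesis using p' by (smt (verit) mult_nonneg_nonpos zero_less_mult_iff)
    qed
    moreover have "q = (fst q - b * fst p) *\<^sub>R (1, 0) + b *\<^sub>R p + (snd q - b * snd p) *\<^sub>R (0, 1)"
      by (simp add: prod_eq_iff)
    moreover have "(fst q - b * fst p) + b + (snd q - b * snd p) = 1" using b by (simp add: algebra_simps)
    ultimately have "q \<in> convex hull {(1, 0), p, (0, 1)}"
      unfolding convex_hull_3 using b(2) by blast
    also have "\<dots> \<subseteq> convex hull (insert (1, 0) F)"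
      by (intro hull_mono) (auto simp: F_def)
    finally show ?thesis .
  qed
  moreover have "insert (1, 0) F \<subseteq> convex hull (insert (1, 0) F)" by (rule hull_subset)
  ultimately have "{(1, 0), (0, 1)} \<union> insert p S \<subseteq> convex hull (insert (1, 0) F)"
    unfolding F_def by blast
  then have "convex hull ({(1, 0), (0, 1)} \<union> insert p S) = convex hull (insert (1, 0) F)"
    by (intro subset_antisym hull_minimal hull_mono) (auto simp: F_def)
  moreover have "{v. v extreme_point_of (convex hull (insert (1, 0) F))}
       = insert (1, 0) {v. v extreme_point_of (convex hull F)}"
    unfolding F_def using fin S lt by (intro extreme_points_insert_apex[OF p]) auto
  moreover have "finite {v. v extreme_point_of (convex hull F)}"
    by (rule finite_subset[OF extreme_points_of_convex_hull]) (use fin in \<open>simp add: F_def\<close>)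
  moreover have "(1, 0) \<notin> {v. v extreme_point_of (convex hull F)}"
  proof -
    have "(1, 0) \<notin> F" using p' S by (fastforce simp: F_def open_triangle_def)
    then show ?thesis using extreme_points_of_convex_hull[of F] by blast
  qed
  ultimately show ?thesis unfolding num_vertices_def F_def[symmetric] by simp
qed

text \<open>The affine map of the unit triangle onto the cap of p that sends (1,0) to p and fixes (0,1), so that
  bases correspond to bases.\<close>

definition cap_map :: "real \<times> real \<Rightarrow> real \<times> real \<Rightarrow> real \<times> real" where
  "cap_map p q = (fst p * fst q, slope p - slope p * fst p * fst q + (1 - slope p) * snd q)"

lemma num_vertices_cap_map:
  assumes p: "p \<in> open_triangle"
  shows "num_vertices (convex hull ({p, (0, 1)} \<union> cap_map p ` S))
       = num_vertices (convex hull ({(1, 0), (0, 1)} \<union> S))"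
proof -
  have p': "0 < fst p" "0 < snd p" "fst p + snd p < 1" using p by (auto simp: open_triangle_def)
  have u: "slope p * (1 - fst p) = snd p" "slope p < 1"
    using p' by (auto simp: slope_def field_simps)
  define f where "f q = (fst p * fst q, (1 - slope p) * snd q - slope p * fst p * fst q)" for q :: "real \<times> real"
  have lin: "linear f" by (rule linearI) (auto simp: f_def algebra_simps)
  have "inj f" using p' u by (intro injI) (auto simp: f_def prod_eq_iff)
  have cm: "cap_map p = (\<lambda>q. (0, slope p) + f q)" by (auto simp: cap_map_def f_def)
  have "cap_map p (1, 0) = p" "cap_map p (0, 1) = (0, 1)"
    using u by (auto simp: cap_map_def prod_eq_iff algebra_simps)
  then have "{p, (0, 1)} \<union> cap_map p ` S = cap_map p ` ({(1, 0), (0, 1)} \<union> S)" by simp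
  also have "convex hull \<dots> = cap_map p ` (convex hull ({(1, 0), (0, 1)} \<union> S))"
  proof -
    have img: "cap_map p ` X = (\<lambda>q. (0, slope p) + q) ` f ` X" for X
      unfolding cm by (simp add: image_image)
    show ?thesis
      unfolding img convex_hull_translation convex_hull_linear_image[OF lin, symmetric] ..
  qed
  finally show ?thesis unfolding cm using num_vertices_affine_image[OF lin \<open>inj f\<close>] by simp
qed

section \<open>Measurability of the number of vertices\<close>

text \<open>Membership in the convex hull of finitely many points is a condition on countably many linear
  functionals: a strictly separating functional may be perturbed into a dense set. This is the source of all
  measurability below.\<close>

lemma countable_separating_directions:
  obtains d :: "nat \<Rightarrow> 'a::euclidean_space" where
    "\<And>F p. finite F \<Longrightarrow> p \<in> convex hull F \<longleftrightarrow> (\<forall>n. \<exists>q\<in>F. d n \<bullet> p \<le> d n \<bullet> q)"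
proof -
  obtain D :: "'a set" where D: "countable D" "\<And>X. open X \<Longrightarrow> X \<noteq> {} \<Longrightarrow> \<exists>d \<in> D. d \<in> X"
    using countable_dense_setE by blast
  have "p \<in> convex hull F \<longleftrightarrow> (\<forall>a\<in>D. \<exists>q\<in>F. a \<bullet> p \<le> a \<bullet> q)" if F: "finite F" for F and p :: 'a
  proof
    assume p: "p \<in> convex hull F"
    show "\<forall>a\<in>D. \<exists>q\<in>F. a \<bullet> p \<le> a \<bullet> q"
    proof (rule ballI, rule ccontr)
      fix a assume "\<not> (\<exists>q\<in>F. a \<bullet> p \<le> a \<bullet> q)"
      then have "F \<subseteq> {q. a \<bullet> q < a \<bullet> p}" by auto
      then have "convex hull F \<subseteq> {q. a \<bullet> q < a \<bullet> p}"
        by (rule hull_minimal) (rule convex_halfspace_lt)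
      with p show False by auto
    qed
  next
    assume *: "\<forall>a\<in>D. \<exists>q\<in>F. a \<bullet> p \<le> a \<bullet> q"
    show "p \<in> convex hull F"
    proof (rule ccontr)
      assume "p \<notin> convex hull F"
      moreover have "closed (convex hull F)"
        using F by (intro compact_imp_closed finite_imp_compact_convex_hull)
      ultimately obtain a b where ab: "a \<bullet> p < b" "\<forall>x\<in>convex hull F. b < a \<bullet> x"
        using separating_hyperplane_closed_point[OF convex_convex_hull] by metis
      let ?X = "\<Inter>q\<in>F. {a. a \<bullet> q < a \<bullet> p}"
      have "open ?X" using F by (intro open_INT ballI open_Collect_less continuous_intros) auto
      moreover have "- a \<in> ?X"
      proof
        fix q assume "q \<in> F"
        then have "b < a \<bullet> q" using ab(2) by (simp add: hull_inc)
        then show "- a \<in> {a. a \<bullet> q < a \<bullet> p}" using ab(1) by simp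
      qed
      ultimately obtain d where "d \<in> D" "d \<in> ?X" using D(2)[of ?X] by blast
      then show False using * by force
    qed
  qed
  moreover have "range (from_nat_into D) = D"
    using D(1) D(2)[of UNIV] by (intro range_from_nat_into) auto
  then have "(\<forall>a\<in>D. P a) \<longleftrightarrow> (\<forall>n. P (from_nat_into D n))" for P by (metis UNIV_I image_iff)
  ultimately show thesis by (intro that[of "from_nat_into D"]) simp
qed

lemma pred_mem_convex_hull:
  fixes p :: "'b \<Rightarrow> 'a::euclidean_space"
  assumes "finite L" and [measurable]: "p \<in> borel_measurable M"
    and Z: "\<And>l. l \<in> L \<Longrightarrow> Z l \<in> borel_measurable M"
  shows "Measurable.pred M (\<lambda>\<omega>. p \<omega> \<in> convex hull ((\<lambda>l. Z l \<omega>) ` L))"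
proof -
  obtain d :: "nat \<Rightarrow> 'a" where d:
    "\<And>F p. finite F \<Longrightarrow> p \<in> convex hull F \<longleftrightarrow> (\<forall>n. \<exists>q\<in>F. d n \<bullet> p \<le> d n \<bullet> q)"
    using countable_separating_directions by blast
  have "Measurable.pred M (\<lambda>\<omega>. \<exists>l\<in>L. d n \<bullet> p \<omega> \<le> d n \<bullet> Z l \<omega>)" for n
  proof (intro pred_intros_finite(4)[OF assms(1)])
    fix l assume "l \<in> L"
    then have [measurable]: "Z l \<in> borel_measurable M" by (rule Z)
    show "Measurable.pred M (\<lambda>\<omega>. d n \<bullet> p \<omega> \<le> d n \<bullet> Z l \<omega>)" by measurable
  qed
  then have "Measurable.pred M (\<lambda>\<omega>. \<forall>n. \<exists>l\<in>L. d n \<bullet> p \<omega> \<le> d n \<bullet> Z l \<omega>)" by measurable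
  then show ?thesis using assms(1) by (simp add: d)
qed

text \<open>The number of vertices expressed by finitely many hull memberships and equalities among the given
  points. The set J selects one index for every vertex, which accounts for points that coincide.\<close>

lemma num_vertices_eq_iff:
  fixes z :: "'k \<Rightarrow> 'a::euclidean_space"
  assumes K: "finite K"
  defines "ex \<equiv> \<lambda>k. \<forall>L\<in>Pow K. (\<forall>l\<in>L. z l \<noteq> z k) \<longrightarrow> z k \<notin> convex hull (z ` L)"
  shows "num_vertices (convex hull (z ` K)) = m \<longleftrightarrow>
     (\<exists>J\<in>Pow K. card J = m \<and> (\<forall>i\<in>J. \<forall>j\<in>J. i \<noteq> j \<longrightarrow> z i \<noteq> z j) \<and>
        (\<forall>j\<in>J. ex j) \<and> (\<forall>k\<in>K. ex k \<longrightarrow> (\<exists>j\<in>J. z j = z k)))" (is "_ \<longleftrightarrow> (\<exists>J\<in>Pow K. ?Q J)")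
proof -
  define E where "E = {v. v extreme_point_of (convex hull (z ` K))}"
  have EK: "E \<subseteq> z ` K" unfolding E_def by (rule extreme_points_of_convex_hull)
  have ex: "z k \<in> E \<longleftrightarrow> ex k" if "k \<in> K" for k
  proof -
    have "z k \<in> E \<longleftrightarrow> z k \<notin> convex hull (z ` K - {z k})"
      using that K by (simp add: E_def extreme_point_of_finite_convex_hull_iff)
    also have "\<dots> \<longleftrightarrow> ex k"
    proof
      assume *: "z k \<notin> convex hull (z ` K - {z k})"
      show "ex k" unfolding ex_def
      proof (intro ballI impI)
        fix L assume "L \<in> Pow K" "\<forall>l\<in>L. z l \<noteq> z k"
        then have "z ` L \<subseteq> z ` K - {z k}" by auto
        then show "z k \<notin> convex hull (z ` L)" using * hull_mono by blast
      qed
    next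
      assume "ex k"
      then have "z k \<notin> convex hull (z ` {l \<in> K. z l \<noteq> z k})" unfolding ex_def by auto
      moreover have "z ` {l \<in> K. z l \<noteq> z k} = z ` K - {z k}" by auto
      ultimately show "z k \<notin> convex hull (z ` K - {z k})" by simp
    qed
    finally show ?thesis .
  qed
  have Q: "inj_on z J \<and> E = z ` J \<longleftrightarrow> (\<forall>i\<in>J. \<forall>j\<in>J. i \<noteq> j \<longrightarrow> z i \<noteq> z j) \<and>
        (\<forall>j\<in>J. ex j) \<and> (\<forall>k\<in>K. ex k \<longrightarrow> (\<exists>j\<in>J. z j = z k))" if J: "J \<subseteq> K" for J
  proof -
    have "E = z ` J \<longleftrightarrow> (\<forall>j\<in>J. z j \<in> E) \<and> (\<forall>k\<in>K. z k \<in> E \<longrightarrow> (\<exists>j\<in>J. z j = z k))"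
    proof (intro iffI conjI ballI impI)
      assume *: "(\<forall>j\<in>J. z j \<in> E) \<and> (\<forall>k\<in>K. z k \<in> E \<longrightarrow> (\<exists>j\<in>J. z j = z k))"
      show "E = z ` J"
      proof (rule set_eqI)
        fix v
        show "v \<in> E \<longleftrightarrow> v \<in> z ` J"
        proof
          assume v: "v \<in> E"
          with EK obtain k where "k \<in> K" "v = z k" by blast
          with * v obtain j where "j \<in> J" "z j = v" by blast
          then show "v \<in> z ` J" by blast
        next
          assume "v \<in> z ` J"
          with * show "v \<in> E" by blast
        qed
      qed
    next
      fix k assume "E = z ` J" "z k \<in> E"
      then obtain j where "j \<in> J" "z k = z j" by blast
      then show "\<exists>j\<in>J. z j = z k" by metis
    qed simp
    also have "\<dots> \<longleftrightarrow> (\<forall>j\<in>J. ex j) \<and> (\<forall>k\<in>K. ex k \<longrightarrow> (\<exists>j\<in>J. z j = z k))"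
      using ex J by blast
    finally show ?thesis unfolding inj_on_def by blast
  qed
  have "card E = m \<longleftrightarrow> (\<exists>J\<in>Pow K. card J = m \<and> inj_on z J \<and> E = z ` J)"
    using EK unfolding subset_image_inj by (auto simp: card_image)
  also have "\<dots> \<longleftrightarrow> (\<exists>J\<in>Pow K. ?Q J)" using Q by (intro bex_cong) auto
  finally show ?thesis by (simp add: num_vertices_def E_def)
qed

lemma measurable_num_vertices:
  fixes Z :: "'k \<Rightarrow> 'b \<Rightarrow> 'a::euclidean_space"
  assumes K: "finite K" and Z: "\<And>k. k \<in> K \<Longrightarrow> Z k \<in> borel_measurable M"
  shows "(\<lambda>\<omega>. num_vertices (convex hull ((\<lambda>k. Z k \<omega>) ` K))) \<in> measurable M (count_space UNIV)"
proof (subst measurable_count_space_eq_countable, simp, intro conjI ballI)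
  fix m :: nat
  have neq: "Measurable.pred M (\<lambda>\<omega>. Z k \<omega> \<noteq> Z j \<omega>)" and eq: "Measurable.pred M (\<lambda>\<omega>. Z k \<omega> = Z j \<omega>)"
    if "k \<in> K" "j \<in> K" for k j
    using Z[OF that(1)] Z[OF that(2)] by measurable
  have ex: "Measurable.pred M (\<lambda>\<omega>. \<forall>L\<in>Pow K. (\<forall>l\<in>L. Z l \<omega> \<noteq> Z k \<omega>) \<longrightarrow> Z k \<omega> \<notin> convex hull ((\<lambda>l. Z l \<omega>) ` L))"
    if k: "k \<in> K" for k
  proof (rule pred_intros_finite(3))
    show "finite (Pow K)" using K by simp
    fix L assume L: "L \<in> Pow K"
    then have "finite L" using finite_subset[OF _ K] by auto
    have [measurable]: "Measurable.pred M (\<lambda>\<omega>. Z k \<omega> \<in> convex hull ((\<lambda>l. Z l \<omega>) ` L))"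
      using \<open>finite L\<close> Z k L by (intro pred_mem_convex_hull) auto
    have [measurable]: "Measurable.pred M (\<lambda>\<omega>. \<forall>l\<in>L. Z l \<omega> \<noteq> Z k \<omega>)"
      using \<open>finite L\<close> L k neq by (intro pred_intros_finite(3)) auto
    show "Measurable.pred M (\<lambda>\<omega>. (\<forall>l\<in>L. Z l \<omega> \<noteq> Z k \<omega>) \<longrightarrow> Z k \<omega> \<notin> convex hull ((\<lambda>l. Z l \<omega>) ` L))"
      by measurable
  qed
  have "Measurable.pred M (\<lambda>\<omega>. num_vertices (convex hull ((\<lambda>k. Z k \<omega>) ` K)) = m)"
    unfolding num_vertices_eq_iff[OF K]
  proof (rule pred_intros_finite(4))
    show "finite (Pow K)" using K by simp
    fix J assume J: "J \<in> Pow K"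
    then have fJ: "finite J" using finite_subset[OF _ K] by auto
    let ?ex = "\<lambda>k \<omega>. \<forall>L\<in>Pow K. (\<forall>l\<in>L. Z l \<omega> \<noteq> Z k \<omega>) \<longrightarrow> Z k \<omega> \<notin> convex hull ((\<lambda>l. Z l \<omega>) ` L)"
    have [measurable]: "Measurable.pred M (\<lambda>\<omega>. \<forall>i\<in>J. \<forall>j\<in>J. i \<noteq> j \<longrightarrow> Z i \<omega> \<noteq> Z j \<omega>)"
    proof (intro pred_intros_finite(3) fJ)
      fix i j assume "i \<in> J" "j \<in> J"
      then have "Measurable.pred M (\<lambda>\<omega>. Z i \<omega> \<noteq> Z j \<omega>)" using J by (intro neq) auto
      then show "Measurable.pred M (\<lambda>\<omega>. i \<noteq> j \<longrightarrow> Z i \<omega> \<noteq> Z j \<omega>)" by measurable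
    qed
    have [measurable]: "Measurable.pred M (\<lambda>\<omega>. \<forall>j\<in>J. ?ex j \<omega>)"
      using fJ J by (intro pred_intros_finite(3) ex) auto
    have [measurable]: "Measurable.pred M (\<lambda>\<omega>. \<forall>k\<in>K. ?ex k \<omega> \<longrightarrow> (\<exists>j\<in>J. Z j \<omega> = Z k \<omega>))"
    proof (intro pred_intros_finite(3) K)
      fix k assume k: "k \<in> K"
      have [measurable]: "Measurable.pred M (?ex k)" using k by (rule ex)
      have [measurable]: "Measurable.pred M (\<lambda>\<omega>. \<exists>j\<in>J. Z j \<omega> = Z k \<omega>)"
        using fJ J k eq by (intro pred_intros_finite(4)) auto
      show "Measurable.pred M (\<lambda>\<omega>. ?ex k \<omega> \<longrightarrow> (\<exists>j\<in>J. Z j \<omega> = Z k \<omega>))" by measurable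
    qed
    show "Measurable.pred M (\<lambda>\<omega>. card J = m \<and> (\<forall>i\<in>J. \<forall>j\<in>J. i \<noteq> j \<longrightarrow> Z i \<omega> \<noteq> Z j \<omega>) \<and>
        (\<forall>j\<in>J. ?ex j \<omega>) \<and> (\<forall>k\<in>K. ?ex k \<omega> \<longrightarrow> (\<exists>j\<in>J. Z j \<omega> = Z k \<omega>)))" by measurable
  qed
  then show "(\<lambda>\<omega>. num_vertices (convex hull ((\<lambda>k. Z k \<omega>) ` K))) -` {m} \<inter> space M \<in> sets M"
    by (simp add: pred_def vimage_def Int_def conj_commute)
qed simp

lemma measurable_num_vertices_with_base:
  fixes Z :: "'k \<Rightarrow> 'b \<Rightarrow> 'a::euclidean_space"
  assumes J: "finite J" and Z: "\<And>j. j \<in> J \<Longrightarrow> Z j \<in> borel_measurable M"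
    and P: "P \<in> borel_measurable M" and Q: "Q \<in> borel_measurable M"
  shows "(\<lambda>\<omega>. num_vertices (convex hull ({P \<omega>, Q \<omega>} \<union> (\<lambda>j. Z j \<omega>) ` J))) \<in> measurable M (count_space UNIV)"
proof -
  define W where "W k = (case k of Inl j \<Rightarrow> Z j | Inr b \<Rightarrow> if b then P else Q)" for k
  let ?K = "Inl ` J \<union> {Inr True, Inr False}"
  have "(\<lambda>\<omega>. num_vertices (convex hull ((\<lambda>k. W k \<omega>) ` ?K))) \<in> measurable M (count_space UNIV)"
    using J Z P Q by (intro measurable_num_vertices) (auto simp: W_def)
  moreover have "(\<lambda>k. W k \<omega>) ` ?K = {P \<omega>, Q \<omega>} \<union> (\<lambda>j. Z j \<omega>) ` J" for \<omega>
    by (auto simp: W_def image_image)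
  ultimately show ?thesis by simp
qed

section \<open>The uniform law on the triangle\<close>

abbreviation triangle_law :: "(real \<times> real) measure" where
  "triangle_law \<equiv> uniform_measure lborel unit_triangle"

lemma unit_triangle_eq: "unit_triangle = {p. 0 \<le> fst p \<and> 0 \<le> snd p \<and> fst p + snd p \<le> 1}"
proof (intro set_eqI iffI)
  fix p assume "p \<in> unit_triangle"
  then show "p \<in> {p. 0 \<le> fst p \<and> 0 \<le> snd p \<and> fst p + snd p \<le> 1}"
    unfolding unit_triangle_def convex_hull_3 by auto
next
  fix p assume p: "p \<in> {p::real\<times>real. 0 \<le> fst p \<and> 0 \<le> snd p \<and> fst p + snd p \<le> 1}"
  then have "p = (1 - fst p - snd p) *\<^sub>R (0, 0) + fst p *\<^sub>R (1, 0) + snd p *\<^sub>R (0, 1)"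
    by (simp add: prod_eq_iff)
  moreover have "(1 - fst p - snd p) + fst p + snd p = 1" by simp
  ultimately show "p \<in> unit_triangle"
    using p unfolding unit_triangle_def convex_hull_3 mem_Collect_eq
    by (metis diff_ge_0_iff_ge diff_diff_eq)
qed

lemma sets_unit_triangle [measurable]: "unit_triangle \<in> sets borel"
  unfolding unit_triangle_def by (intro borel_closed compact_imp_closed finite_imp_compact_convex_hull) simp

lemma borel_measurable_fst_real [measurable (raw)]:
  fixes f :: "'b \<Rightarrow> real \<times> real"
  assumes "f \<in> borel_measurable M"
  shows "(\<lambda>x. fst (f x)) \<in> borel_measurable M"
  using measurable_compose[OF assms borel_measurable_continuous_onI[OF continuous_on_fst[OF continuous_on_id]]] .

lemma borel_measurable_snd_real [measurable (raw)]:
  fixes f :: "'b \<Rightarrow> real \<times> real"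
  assumes "f \<in> borel_measurable M"
  shows "(\<lambda>x. snd (f x)) \<in> borel_measurable M"
  using measurable_compose[OF assms borel_measurable_continuous_onI[OF continuous_on_snd[OF continuous_on_id]]] .

lemma nn_integral_lborel_pair:
  assumes [measurable]: "f \<in> borel_measurable borel"
  shows "(\<integral>\<^sup>+p. f p \<partial>(lborel :: (real \<times> real) measure)) = (\<integral>\<^sup>+x. \<integral>\<^sup>+y. f (x, y) \<partial>lborel \<partial>lborel)"
proof -
  have "f \<in> borel_measurable (lborel \<Otimes>\<^sub>M lborel)" by (simp add: lborel_prod)
  then show ?thesis
    using lborel.nn_integral_fst[of f lborel] by (simp add: lborel_prod)
qed

text \<open>The coordinates are r, the fraction of the way from (1,0) to the vertical axis, and the slope u. The
  Jacobian is r, so that under the uniform law r and u are independent, u is uniform and r has density 2r.\<close>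

lemma nn_integral_unit_triangle_polar:
  assumes [measurable]: "g \<in> borel_measurable borel"
  shows "(\<integral>\<^sup>+p. indicator unit_triangle p * g p \<partial>lborel)
       = (\<integral>\<^sup>+r. indicator {0<..<1} r * (ennreal r * (\<integral>\<^sup>+u. indicator {0<..<1} u * g (1 - r, r * u) \<partial>lborel)) \<partial>lborel)"
proof -
  let ?h = "\<lambda>p. indicator unit_triangle p * g p"
  have "(\<integral>\<^sup>+p. ?h p \<partial>lborel) = (\<integral>\<^sup>+x. \<integral>\<^sup>+y. ?h (x, y) \<partial>lborel \<partial>lborel)"
    by (rule nn_integral_lborel_pair) simp
  also have "\<dots> = (\<integral>\<^sup>+r. \<integral>\<^sup>+y. ?h (1 - r, y) \<partial>lborel \<partial>lborel)"
    by (subst nn_integral_real_affine[where c = "-1" and t = 1]) auto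
  also have "\<dots> = (\<integral>\<^sup>+r. indicator {0<..<1} r * (ennreal r * (\<integral>\<^sup>+u. indicator {0<..<1} u * g (1 - r, r * u) \<partial>lborel)) \<partial>lborel)"
  proof (rule nn_integral_cong_AE, use AE_lborel_singleton[of 0] AE_lborel_singleton[of 1] in eventually_elim)
    fix r :: real assume r: "r \<noteq> 0" "r \<noteq> 1"
    show "(\<integral>\<^sup>+y. ?h (1 - r, y) \<partial>lborel)
      = indicator {0<..<1} r * (ennreal r * (\<integral>\<^sup>+u. indicator {0<..<1} u * g (1 - r, r * u) \<partial>lborel))"
    proof (cases "r \<in> {0<..<1}")
      case False
      then have zero: "?h (1 - r, y) = 0" for y using r by (auto simp: unit_triangle_eq indicator_def)
      show ?thesis unfolding zero using False by simp
    next
      case True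
      then have "(\<integral>\<^sup>+y. ?h (1 - r, y) \<partial>lborel) = ennreal r * (\<integral>\<^sup>+u. ?h (1 - r, r * u) \<partial>lborel)"
        by (subst nn_integral_real_affine[where c = r and t = 0]) auto
      also have "(\<integral>\<^sup>+u. ?h (1 - r, r * u) \<partial>lborel) = (\<integral>\<^sup>+u. indicator {0<..<1} u * g (1 - r, r * u) \<partial>lborel)"
        by (rule nn_integral_cong_AE, use AE_lborel_singleton[of 0] AE_lborel_singleton[of 1] in eventually_elim)
           (use True in \<open>auto simp: unit_triangle_eq indicator_def zero_le_mult_iff mult_le_cancel_left1\<close>)
      finally show ?thesis using True by simp
    qed
  qed
  finally show ?thesis .
qed

lemma nn_integral_Beta_nat:
  "(\<integral>\<^sup>+r. indicator {0<..<1} r * ennreal (r ^ k * (1 - r) ^ m) \<partial>lborel)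
      = ennreal (fact k * fact m / fact (k + m + 1))"
proof -
  have "((\<lambda>t. t powr (real (Suc k) - 1) * (1 - t) powr (real (Suc m) - 1)) has_integral
      Beta (real (Suc k)) (real (Suc m))) {0..1}"
    by (rule has_integral_Beta_real) auto
  then have "(\<integral>\<^sup>+r. ennreal (r powr (real (Suc k) - 1) * (1 - r) powr (real (Suc m) - 1)) * indicator {0..1} r \<partial>lborel)
      = ennreal (Beta (real (Suc k)) (real (Suc m)))"
    by (intro nn_integral_has_integral_lebesgue') auto
  also have "Beta (real (Suc k)) (real (Suc m)) = fact k * fact m / fact (k + m + 1)"
  proof -
    have "real (Suc k) + real (Suc m) = real (Suc (k + m + 1))" by simp
    then show ?thesis unfolding Beta_def by (simp only: Gamma_fact[symmetric] of_nat_Suc add_ac)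
  qed
  also have "(\<integral>\<^sup>+r. ennreal (r powr (real (Suc k) - 1) * (1 - r) powr (real (Suc m) - 1)) * indicator {0..1} r \<partial>lborel)
     = (\<integral>\<^sup>+r. indicator {0<..<1} r * ennreal (r ^ k * (1 - r) ^ m) \<partial>lborel)"
    by (rule nn_integral_cong_AE, use AE_lborel_singleton[of 0] AE_lborel_singleton[of 1] in eventually_elim)
       (auto simp: indicator_def powr_realpow)
  finally show ?thesis .
qed

lemma nn_integral_power_Icc:
  "(\<integral>\<^sup>+u. indicator {0<..<1} u * ennreal ((1 - u) ^ n) \<partial>lborel) = ennreal (1 / (real n + 1))"
  using nn_integral_Beta_nat[of 0 n] by (simp add: add_ac)

lemma emeasure_unit_triangle: "emeasure lborel unit_triangle = ennreal (1 / 2)"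
proof -
  have "emeasure lborel unit_triangle = (\<integral>\<^sup>+p. indicator unit_triangle p * 1 \<partial>lborel)" by simp
  also have "\<dots> = (\<integral>\<^sup>+r. indicator {0<..<1} r * ennreal r \<partial>(lborel :: real measure))"
    by (subst nn_integral_unit_triangle_polar) auto
  also have "\<dots> = (\<integral>\<^sup>+r. indicator {0<..<1} (1 - r) * ennreal (1 - r) \<partial>(lborel :: real measure))"
    by (subst nn_integral_real_affine[where c = "-1" and t = 1]) auto
  also have "\<dots> = (\<integral>\<^sup>+r. indicator {0<..<1} r * ennreal ((1 - r) ^ 1) \<partial>(lborel :: real measure))"
    by (intro nn_integral_cong) (auto simp: indicator_def)
  also have "\<dots> = ennreal (1 / 2)" unfolding nn_integral_power_Icc by simp
  finally show ?thesis .
qed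

lemma nn_integral_triangle_law:
  assumes [measurable]: "g \<in> borel_measurable borel"
  shows "(\<integral>\<^sup>+p. g p \<partial>triangle_law) = 2 * (\<integral>\<^sup>+p. indicator unit_triangle p * g p \<partial>lborel)"
proof -
  have "inverse (ennreal (1 / 2)) = ennreal (inverse (1 / 2))" by (rule inverse_ennreal) simp
  also have "\<dots> = 2" by simp
  finally have "inverse (ennreal (1 / 2)) = 2" .
  then have half: "x / ennreal (1 / 2) = 2 * x" for x
    unfolding divide_ennreal_def by (metis mult.commute)
  have "(\<integral>\<^sup>+p. g p \<partial>triangle_law) = (\<integral>\<^sup>+p. g p * indicator unit_triangle p \<partial>lborel) / ennreal (1 / 2)"
    unfolding emeasure_unit_triangle[symmetric] by (rule nn_integral_uniform_measure) auto
  then show ?thesis unfolding half by (simp only: mult.commute[of "g _"])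
qed

lemma nn_integral_triangle_law_polar:
  assumes [measurable]: "g \<in> borel_measurable borel"
  shows "(\<integral>\<^sup>+p. g p \<partial>triangle_law)
     = (\<integral>\<^sup>+r. indicator {0<..<1} r * (ennreal (2 * r) * (\<integral>\<^sup>+u. indicator {0<..<1} u * g (1 - r, r * u) \<partial>lborel)) \<partial>lborel)"
proof -
  let ?K = "\<lambda>r. \<integral>\<^sup>+u. indicator {0<..<1} u * g (1 - r, r * u) \<partial>lborel"
  have "(\<integral>\<^sup>+p. g p \<partial>triangle_law) = 2 * (\<integral>\<^sup>+r. indicator {0<..<1} r * (ennreal r * ?K r) \<partial>lborel)"
    unfolding nn_integral_triangle_law[OF assms] nn_integral_unit_triangle_polar[OF assms] ..
  also have "\<dots> = (\<integral>\<^sup>+r. 2 * (indicator {0<..<1} r * (ennreal r * ?K r)) \<partial>lborel)"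
    by (rule nn_integral_cmult[symmetric]) measurable
  also have "\<dots> = (\<integral>\<^sup>+r. indicator {0<..<1} r * (ennreal (2 * r) * ?K r) \<partial>lborel)"
    by (intro nn_integral_cong) (simp add: ennreal_mult' mult.assoc split: split_indicator)
  finally show ?thesis .
qed

lemma prob_space_triangle_law: "prob_space triangle_law"
  by (rule prob_space_uniform_measure) (auto simp: emeasure_unit_triangle)

lemma AE_triangle_law_open: "AE p in triangle_law. p \<in> open_triangle"
proof -
  have [measurable]: "open_triangle \<in> sets borel" unfolding open_triangle_def by measurable
  have "emeasure triangle_law (- open_triangle) = (\<integral>\<^sup>+p. indicator (- open_triangle) p \<partial>triangle_law)"
    by (subst nn_integral_indicator) auto
  also have "\<dots> = 0"
  proof (subst nn_integral_triangle_law_polar)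
    have "indicator {0<..<1} u * indicator (- open_triangle) (1 - r, r * u) = (0 :: ennreal)"
      if "r \<in> {0<..<1}" for r u :: real
      using that by (auto simp: open_triangle_def indicator_def)
    note zero = this
    have "indicator {0<..<1} r * (ennreal (2 * r) * (\<integral>\<^sup>+u. indicator {0<..<1} u
        * indicator (- open_triangle) (1 - r, r * u) \<partial>lborel)) = 0" for r :: real
    proof (cases "r \<in> {0<..<1}")
      case True
      with zero show ?thesis by (simp only: nn_integral_const mult_zero_left mult_zero_right)
    next
      case False
      then show ?thesis by (simp add: indicator_def del: greaterThanLessThan_iff)
    qed
    then show "(\<integral>\<^sup>+r. indicator {0<..<1} r * (ennreal (2 * r) * (\<integral>\<^sup>+u. indicator {0<..<1} u
        * indicator (- open_triangle) (1 - r, r * u) \<partial>lborel)) \<partial>lborel) = 0"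
      by (simp only: nn_integral_const mult_zero_left)
  qed simp
  finally show ?thesis
    by (intro AE_I[where N = "- open_triangle"]) auto
qed

lemma AE_triangle_law_slope: "AE p in triangle_law. slope p \<noteq> c"
proof -
  have [measurable]: "slope \<in> borel_measurable borel" unfolding slope_def [abs_def] by measurable
  have "emeasure triangle_law {p. slope p = c} = (\<integral>\<^sup>+p. indicator {p. slope p = c} p \<partial>triangle_law)"
    by (subst nn_integral_indicator) auto
  also have "\<dots> = 0"
  proof (subst nn_integral_triangle_law_polar)
    have "(\<integral>\<^sup>+u. indicator {0<..<1} u * indicator {p. slope p = c} (1 - r, r * u) \<partial>lborel) = (0::ennreal)"
      if "r \<in> {0<..<1}" for r :: real
    proof -
      have "(\<integral>\<^sup>+u. indicator {0<..<1} u * indicator {p. slope p = c} (1 - r, r * u) \<partial>lborel)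
          \<le> (\<integral>\<^sup>+u. indicator {c} u \<partial>(lborel :: real measure))"
        by (intro nn_integral_mono) (use that in \<open>auto simp: slope_def indicator_def\<close>)
      then show ?thesis by simp
    qed
    then show "(\<integral>\<^sup>+r. indicator {0<..<1} r * (ennreal (2 * r) * (\<integral>\<^sup>+u. indicator {0<..<1} u * indicator {p. slope p = c} (1 - r, r * u) \<partial>lborel)) \<partial>lborel) = 0"
      by (intro nn_integral_zero') (auto split: split_indicator)
  qed simp
  finally show ?thesis
    by (intro AE_I[where N = "{p. slope p = c}"]) auto
qed

text \<open>Conditioning the uniform law on an affine copy of the triangle gives the image of the uniform law.
  Triangular maps suffice, and for these the change of variables is two one-dimensional substitutions.\<close>

lemma nn_integral_triangle_law_affine:
  fixes a b c d :: real
  defines "\<phi> \<equiv> \<lambda>q. (a * fst q, b + c * fst q + d * snd q)"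
  assumes pos: "a > 0" "d > 0" and [measurable]: "A \<in> sets borel" "g \<in> borel_measurable borel"
    and A: "\<And>q. \<phi> q \<in> A \<inter> unit_triangle \<longleftrightarrow> q \<in> unit_triangle"
  shows "(\<integral>\<^sup>+q. indicator A q * g q \<partial>triangle_law) = ennreal (a * d) * (\<integral>\<^sup>+q. g (\<phi> q) \<partial>triangle_law)"
proof -
  let ?h = "\<lambda>q. indicator (A \<inter> unit_triangle) q * g q"
  have [measurable]: "\<phi> \<in> borel_measurable borel" unfolding \<phi>_def by measurable
  have "(\<integral>\<^sup>+q. ?h q \<partial>lborel) = (\<integral>\<^sup>+x. \<integral>\<^sup>+y. ?h (x, y) \<partial>lborel \<partial>lborel)"
    by (rule nn_integral_lborel_pair) simp
  also have "\<dots> = ennreal a * (\<integral>\<^sup>+x. \<integral>\<^sup>+y. ?h (a * x, y) \<partial>lborel \<partial>lborel)"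
    using pos by (subst nn_integral_real_affine[where c = a and t = 0]) auto
  also have "(\<lambda>x. \<integral>\<^sup>+y. ?h (a * x, y) \<partial>lborel) = (\<lambda>x. ennreal d * (\<integral>\<^sup>+y. ?h (\<phi> (x, y)) \<partial>lborel))"
    using pos by (intro ext, subst nn_integral_real_affine[where c = d and t = "b + c * x" for x])
      (auto simp: \<phi>_def)
  also have "ennreal a * (\<integral>\<^sup>+x. ennreal d * (\<integral>\<^sup>+y. ?h (\<phi> (x, y)) \<partial>lborel) \<partial>lborel)
      = ennreal (a * d) * (\<integral>\<^sup>+x. \<integral>\<^sup>+y. ?h (\<phi> (x, y)) \<partial>lborel \<partial>lborel)"
    using pos by (subst nn_integral_cmult) (auto simp: ennreal_mult mult.assoc)
  also have "(\<integral>\<^sup>+x. \<integral>\<^sup>+y. ?h (\<phi> (x, y)) \<partial>lborel \<partial>lborel) = (\<integral>\<^sup>+q. ?h (\<phi> q) \<partial>lborel)"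
    by (rule nn_integral_lborel_pair[symmetric]) simp
  also have "(\<lambda>q. ?h (\<phi> q)) = (\<lambda>q. indicator unit_triangle q * g (\<phi> q))"
    using A by (auto simp: indicator_def fun_eq_iff)
  finally have "(\<integral>\<^sup>+q. ?h q \<partial>lborel) = ennreal (a * d) * (\<integral>\<^sup>+q. indicator unit_triangle q * g (\<phi> q) \<partial>lborel)" .
  then have "2 * (\<integral>\<^sup>+q. indicator unit_triangle q * (indicator A q * g q) \<partial>lborel)
      = ennreal (a * d) * (2 * (\<integral>\<^sup>+q. indicator unit_triangle q * g (\<phi> q) \<partial>lborel))"
    by (simp add: indicator_inter_arith mult_ac)
  then show ?thesis by (subst (1 2) nn_integral_triangle_law) auto
qed

text \<open>The points seen from (1,0) under an angle at least that of p.\<close>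

definition beyond :: "real \<times> real \<Rightarrow> (real \<times> real) set" where
  "beyond p = {q. slope p * (1 - fst q) \<le> snd q}"

lemma sets_cap [measurable]: "cap p \<in> sets borel"
  unfolding cap_def by measurable

lemma sets_beyond [measurable]: "beyond p \<in> sets borel"
  unfolding beyond_def by measurable

lemma cap_subset_beyond: "cap p \<subseteq> beyond p" by (auto simp: cap_def beyond_def)

lemma measurable_cap_map [measurable]: "cap_map p \<in> borel_measurable borel"
  unfolding cap_map_def [abs_def] by measurable

lemma slope_bounds:
  assumes "p \<in> open_triangle"
  shows "0 < slope p" "slope p < 1" "slope p * (1 - fst p) = snd p" "0 < fst p" "fst p < 1"
  using assms by (auto simp: open_triangle_def slope_def field_simps)

lemma nn_integral_cap:
  assumes p: "p \<in> open_triangle" and [measurable]: "g \<in> borel_measurable borel"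
  shows "(\<integral>\<^sup>+q. indicator (cap p) q * g q \<partial>triangle_law)
       = ennreal (fst p * (1 - slope p)) * (\<integral>\<^sup>+q. g (cap_map p q) \<partial>triangle_law)"
proof -
  note u = slope_bounds[OF p]
  let ?u = "slope p"
  let ?\<phi> = "\<lambda>q. (fst p * fst q, ?u + (- (?u * fst p)) * fst q + (1 - ?u) * snd q)"
  have "?\<phi> q \<in> cap p \<inter> unit_triangle \<longleftrightarrow> q \<in> unit_triangle" for q
  proof -
    have 1: "0 \<le> fst (?\<phi> q) \<longleftrightarrow> 0 \<le> fst q" using u by (simp add: zero_le_mult_iff)
    have "snd (?\<phi> q) - ?u * (1 - fst (?\<phi> q)) = (1 - ?u) * snd q" by (simp add: algebra_simps)
    then have 2: "?u * (1 - fst (?\<phi> q)) \<le> snd (?\<phi> q) \<longleftrightarrow> 0 \<le> snd q"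
      using u by (smt (verit) zero_le_mult_iff)
    have "fst p * (1 - snd (?\<phi> q)) - fst (?\<phi> q) * (1 - snd p)
        = fst p * ((1 - ?u) * (1 - fst q - snd q))"
      unfolding u(3)[symmetric] by (simp add: algebra_simps)
    then have 3: "fst (?\<phi> q) * (1 - snd p) \<le> fst p * (1 - snd (?\<phi> q)) \<longleftrightarrow> fst q + snd q \<le> 1"
      using u by (smt (verit) zero_le_mult_iff)
    have "?\<phi> q \<in> unit_triangle" if q: "0 \<le> fst q" "0 \<le> snd q" "fst q + snd q \<le> 1"
    proof -
      have pq: "fst p * fst q \<le> fst q" using u q by (simp add: mult_left_le_one_le)
      then have "0 \<le> ?u * (1 - fst p * fst q) + (1 - ?u) * snd q"
        using u q by (intro add_nonneg_nonneg mult_nonneg_nonneg) auto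
      moreover have "(1 - ?u) * (fst p * fst q + snd q) \<le> (1 - ?u) * 1"
        using u q pq by (intro mult_left_mono) auto
      ultimately show ?thesis using u q by (simp add: unit_triangle_eq algebra_simps)
    qed
    then show ?thesis using 1 2 3 unfolding Int_iff cap_def mem_Collect_eq
      by (auto simp: unit_triangle_eq)
  qed
  from nn_integral_triangle_law_affine[OF _ _ sets_cap assms(2) this] u
  show ?thesis by (simp add: cap_map_def)
qed

lemma emeasure_cap:
  assumes p: "p \<in> open_triangle"
  shows "emeasure triangle_law (cap p) = ennreal (fst p * (1 - slope p))"
  using nn_integral_cap[OF p, of "\<lambda>_. 1"] prob_space.emeasure_space_1[OF prob_space_triangle_law]
  by simp

lemma emeasure_beyond:
  assumes p: "p \<in> open_triangle"
  shows "emeasure triangle_law (beyond p) = ennreal (1 - slope p)"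
proof -
  note u = slope_bounds[OF p]
  let ?u = "slope p"
  let ?\<phi> = "\<lambda>q. (1 * fst q, ?u + (- ?u) * fst q + (1 - ?u) * snd q)"
  have "?\<phi> q \<in> beyond p \<inter> unit_triangle \<longleftrightarrow> q \<in> unit_triangle" for q :: "real \<times> real"
  proof -
    have "snd (?\<phi> q) - ?u * (1 - fst (?\<phi> q)) = (1 - ?u) * snd q" by (simp add: algebra_simps)
    then have 2: "?u * (1 - fst (?\<phi> q)) \<le> snd (?\<phi> q) \<longleftrightarrow> 0 \<le> snd q"
      using u by (smt (verit) zero_le_mult_iff)
    have "1 - (fst (?\<phi> q) + snd (?\<phi> q)) = (1 - ?u) * (1 - fst q - snd q)" by (simp add: algebra_simps)
    then have 3: "fst (?\<phi> q) + snd (?\<phi> q) \<le> 1 \<longleftrightarrow> fst q + snd q \<le> 1"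
      using u by (smt (verit) zero_le_mult_iff)
    have 4: "0 \<le> snd (?\<phi> q)" if "0 \<le> fst q" "0 \<le> snd q" "fst q + snd q \<le> 1"
    proof -
      have "0 \<le> ?u * (1 - fst q) + (1 - ?u) * snd q"
        using u that by (intro add_nonneg_nonneg mult_nonneg_nonneg) auto
      then show ?thesis by (simp add: algebra_simps)
    qed
    show ?thesis using 2 3 4 unfolding Int_iff beyond_def unit_triangle_eq mem_Collect_eq by auto
  qed
  from nn_integral_triangle_law_affine[OF _ _ sets_beyond _ this, of "\<lambda>_. 1"] u
    prob_space.emeasure_space_1[OF prob_space_triangle_law]
  show ?thesis by simp
qed

lemma emeasure_beyond_diff_cap:
  assumes p: "p \<in> open_triangle"
  shows "emeasure triangle_law (beyond p - cap p) = ennreal ((1 - fst p) * (1 - slope p))"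
  using slope_bounds[OF p]
  by (subst emeasure_Diff) (auto simp: cap_subset_beyond emeasure_cap[OF p] emeasure_beyond[OF p]
      ennreal_minus algebra_simps)

text \<open>If p is the first vertex among k + m + 1 points, the other k + m points lie beyond p, of which m in
  the cap and k outside it. The integrand is the probability that prescribed sets of k and m points fall
  there. In polar coordinates it factorises into (1-u)^n and a Beta integrand in r.\<close>

lemma nn_integral_split_weight:
  assumes "m + k = n"
  shows "(\<integral>\<^sup>+p. ennreal (((1 - fst p) * (1 - slope p)) ^ k * (fst p * (1 - slope p)) ^ m) \<partial>triangle_law)
    = ennreal (2 * fact (k + 1) * fact m / ((real n + 1) * fact (n + 2)))"
proof -
  have [measurable]: "slope \<in> borel_measurable borel" unfolding slope_def [abs_def] by measurable
  let ?g = "\<lambda>p. ennreal (((1 - fst p) * (1 - slope p)) ^ k * (fst p * (1 - slope p)) ^ m)"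
  have "(\<integral>\<^sup>+p. ?g p \<partial>triangle_law)
     = (\<integral>\<^sup>+r. indicator {0<..<1} r * (ennreal (2 * r) * (\<integral>\<^sup>+u. indicator {0<..<1} u * ?g (1 - r, r * u) \<partial>lborel)) \<partial>lborel)"
    by (rule nn_integral_triangle_law_polar) measurable
  also have "\<dots> = (\<integral>\<^sup>+r. ennreal (2 / (real n + 1)) * (indicator {0<..<1} r * ennreal (r ^ (k + 1) * (1 - r) ^ m)) \<partial>lborel)"
  proof (rule nn_integral_cong)
    fix r :: real
    show "indicator {0<..<1} r * (ennreal (2 * r) * (\<integral>\<^sup>+u. indicator {0<..<1} u * ?g (1 - r, r * u) \<partial>lborel))
        = ennreal (2 / (real n + 1)) * (indicator {0<..<1} r * ennreal (r ^ (k + 1) * (1 - r) ^ m))"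
    proof (cases "r \<in> {0<..<1}")
      case True
      have "(\<integral>\<^sup>+u. indicator {0<..<1} u * ?g (1 - r, r * u) \<partial>lborel)
          = (\<integral>\<^sup>+u. ennreal (r ^ k * (1 - r) ^ m) * (indicator {0<..<1} u * ennreal ((1 - u) ^ n)) \<partial>lborel)"
        using True assms
        by (intro nn_integral_cong)
           (auto simp: indicator_def slope_def power_mult_distrib mult_ac power_add simp flip: ennreal_mult'')
      also have "\<dots> = ennreal (r ^ k * (1 - r) ^ m) * ennreal (1 / (real n + 1))"
        by (subst nn_integral_cmult) (auto simp: nn_integral_power_Icc)
      finally show ?thesis using True by (simp add: mult_ac flip: ennreal_mult'')
    qed simp
  qed
  also have "\<dots> = ennreal (2 / (real n + 1)) * ennreal (fact (k + 1) * fact m / fact (k + 1 + m + 1))"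
    by (subst nn_integral_cmult) (simp_all only: nn_integral_Beta_nat, measurable)
  also have "k + 1 + m + 1 = n + 2" using assms by simp
  finally show ?thesis by (simp add: mult_ac flip: ennreal_mult'')
qed

section \<open>Growth of the generating function\<close>

text \<open>The generating function of the number of steps in which the Markov chain that jumps from n to m < n with
  probability 2 (n - m) / (n (n + 1)) reaches 0. The number of points left in the cap of the first
  vertex has this law, so that the steps count the random vertices.\<close>

fun chain_gf :: "real \<Rightarrow> nat \<Rightarrow> real" where
  "chain_gf z n = (if n = 0 then 1 else
     2 * z / (real n * (real n + 1)) * (\<Sum>m<n. (real n - real m) * chain_gf z m))"

declare chain_gf.simps [simp del]

lemma chain_gf_0 [simp]: "chain_gf z 0 = 1" by (simp add: chain_gf.simps)

lemma chain_gf_rec: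
  "real n * (real n + 1) * chain_gf z n = 2 * z * (\<Sum>m<n. (real n - real m) * chain_gf z m)"
proof (cases "n = 0")
  case False
  then have "real n * (real n + 1) \<noteq> 0" by (simp add: add_nonneg_eq_0_iff)
  then show ?thesis using False by (subst chain_gf.simps) simp
qed simp

lemma chain_gf_pos:
  assumes "z > 0"
  shows "chain_gf z n > 0"
proof (induction n rule: less_induct)
  case (less n)
  show ?case
  proof (cases "n = 0")
    case False
    then have "(\<Sum>m<n. (real n - real m) * chain_gf z m) > 0"
      using less by (intro sum_pos) auto
    then show ?thesis using False assms by (subst chain_gf.simps) simp
  qed simp
qed

text \<open>The coefficients of (1 - t)^(-b-1), which grow like n^b and for which the sum in the recursion has a
  closed form.\<close>

definition comparison :: "real \<Rightarrow> nat \<Rightarrow> real" where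
  "comparison b n = pochhammer (b + 1) n / fact n"

lemma comparison_0 [simp]: "comparison b 0 = 1" by (simp add: comparison_def)

lemma comparison_Suc: "(real n + 1) * comparison b (Suc n) = (real n + b + 1) * comparison b n"
proof -
  have "fact (Suc n) = (real n + 1) * fact n" by (simp add: algebra_simps)
  then have "(real n + 1) * comparison b (Suc n)
      = (real n + 1) * (pochhammer (b + 1) n * (b + 1 + real n)) / ((real n + 1) * fact n)"
    by (simp only: comparison_def pochhammer_Suc times_divide_eq_right)
  also have "\<dots> = pochhammer (b + 1) n * (b + 1 + real n) / fact n"
    by (rule mult_divide_mult_cancel_left) simp
  finally show ?thesis by (simp add: comparison_def add_ac)
qed

lemma comparison_pos: "b > -1 \<Longrightarrow> comparison b n > 0"
  by (simp add: comparison_def pochhammer_pos)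

lemma sum_comparison:
  assumes "b > -1"
  shows "(b + 1) * (\<Sum>m\<le>n. comparison b m) = (real n + b + 1) * comparison b n"
proof (induction n)
  case (Suc n)
  then show ?case using comparison_Suc[of n b] by (simp add: algebra_simps)
qed simp

lemma weighted_sum_comparison:
  assumes "b > -1"
  shows "(b + 1) * (b + 2) * (\<Sum>m<n. (real n - real m) * comparison b m)
       = real n * (real n + b + 1) * comparison b n"
proof (induction n)
  case (Suc n)
  have "(\<Sum>m<Suc n. (real (Suc n) - real m) * comparison b m)
      = (\<Sum>m<n. (real n - real m) * comparison b m) + (\<Sum>m\<le>n. comparison b m)"
    by (simp add: lessThan_Suc_atMost[symmetric] sum.distrib sum_subtractf algebra_simps)
  then have "(b + 1) * (b + 2) * (\<Sum>m<Suc n. (real (Suc n) - real m) * comparison b m)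
     = real n * (real n + b + 1) * comparison b n + (b + 2) * ((b + 1) * (\<Sum>m\<le>n. comparison b m))"
    using Suc by (simp add: algebra_simps)
  also have "\<dots> = (real n + b + 2) * ((real n + b + 1) * comparison b n)"
    unfolding sum_comparison[OF assms] by (simp add: algebra_simps)
  also have "\<dots> = (real n + b + 2) * ((real n + 1) * comparison b (Suc n))"
    unfolding comparison_Suc ..
  finally show ?case by (simp add: algebra_simps)
qed simp

lemma comparison_growth:
  assumes "b > -1"
  shows "(\<lambda>n. ln (comparison b n) / ln (real n)) \<longlonglongrightarrow> b"
proof -
  let ?G = "Gamma_series (b + 1)"
  have ev: "\<forall>\<^sub>F n in sequentially. ln (comparison b n) / ln (real n)
      = b + 1 - ln (real n + b + 1) / ln (real n) - ln (?G n) / ln (real n)"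
    using eventually_gt_at_top[of 1]
  proof eventually_elim
    case (elim n)
    have p: "pochhammer (b + 1) n > 0" using assms by (simp add: pochhammer_pos)
    have G: "?G n = real n powr (b + 1) / ((real n + b + 1) * comparison b n)"
      using elim p assms
      by (simp add: Gamma_series_def comparison_def pochhammer_Suc powr_def field_simps)
    have "ln (?G n) = (b + 1) * ln (real n) - (ln (real n + b + 1) + ln (comparison b n))"
      unfolding G using elim assms comparison_pos[OF assms, of n]
      by (simp add: ln_div ln_mult ln_powr)
    then have "ln (comparison b n) = (b + 1) * ln (real n) - ln (real n + b + 1) - ln (?G n)" by simp
    then show ?case using elim by (simp add: diff_divide_distrib)
  qed
  have Gam: "Gamma (b + 1) > 0" using assms by (intro Gamma_real_pos) auto
  have l: "filterlim (\<lambda>n. ln (real n)) at_top sequentially"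
    by (intro filterlim_compose[OF ln_at_top] filterlim_real_sequentially)
  have 1: "(\<lambda>n. ln (real n + b + 1) / ln (real n)) \<longlonglongrightarrow> 1" by real_asymp
  have 2: "(\<lambda>n. ln (?G n) / ln (real n)) \<longlonglongrightarrow> 0"
    using Gam by (intro real_tendsto_divide_at_top[OF tendsto_ln[OF Gamma_series_LIMSEQ] l]) auto
  show ?thesis
    using tendsto_diff[OF tendsto_diff[OF tendsto_const[of "b + 1"] 1] 2] ev
    by (simp add: tendsto_cong)
qed

text \<open>Inserting the comparison sequence into the recursion multiplies it, for large n, by almost
  2 z / ((b+1) (b+2)). If this is less than 1, the sequence is a supersolution from some index N on, and a
  large constant takes care of the indices up to N.\<close>

lemma chain_gf_le_comparison:
  assumes "b > -1" "z > 0" "(b + 1) * (b + 2) > 2 * z"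
  obtains C where "C > 0" "\<And>n. chain_gf z n \<le> C * comparison b n"
proof -
  have "eventually (\<lambda>n. 2 * z * (real n + b + 1) \<le> (b + 1) * (b + 2) * (real n + 1)) sequentially"
    using assms by real_asymp
  then obtain N where N: "\<And>n. n \<ge> N \<Longrightarrow> 2 * z * (real n + b + 1) \<le> (b + 1) * (b + 2) * (real n + 1)"
    by (auto simp: eventually_sequentially)
  define C where "C = (\<Sum>n\<le>N. chain_gf z n / comparison b n)"
  have pos: "0 < chain_gf z n / comparison b n" for n
    using chain_gf_pos[OF assms(2)] comparison_pos[OF assms(1)] by simp
  have C: "C > 0" unfolding C_def using pos by (intro sum_pos) auto
  have "chain_gf z n \<le> C * comparison b n" for n
  proof (induction n rule: less_induct)
    case (less n)
    note cp = comparison_pos[OF assms(1)]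
    show ?case
    proof (cases "n \<le> N")
      case True
      then have "chain_gf z n / comparison b n \<le> C"
        unfolding C_def using pos by (intro member_le_sum) (auto intro: less_imp_le)
      then show ?thesis using cp[of n] by (simp add: field_simps)
    next
      case False
      then have n: "n > 0" "n \<ge> N" by auto
      have "real n * (real n + 1) * chain_gf z n \<le> 2 * z * (\<Sum>m<n. (real n - real m) * (C * comparison b m))"
        unfolding chain_gf_rec using less assms by (intro mult_left_mono sum_mono) auto
      also have "\<dots> = 2 * z * C * (\<Sum>m<n. (real n - real m) * comparison b m)"
        by (simp add: sum_distrib_left mult_ac)
      finally have "((b + 1) * (b + 2)) * (real n * (real n + 1) * chain_gf z n)
          \<le> ((b + 1) * (b + 2)) * (2 * z * C * (\<Sum>m<n. (real n - real m) * comparison b m))"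
        using assms by (intro mult_left_mono) auto
      also have "\<dots> = 2 * z * C * (real n * (real n + b + 1) * comparison b n)"
        using weighted_sum_comparison[OF assms(1), of n] by (simp add: mult_ac)
      also have "\<dots> = (C * real n * comparison b n) * (2 * z * (real n + b + 1))" by (simp add: mult_ac)
      also have "\<dots> \<le> (C * real n * comparison b n) * ((b + 1) * (b + 2) * (real n + 1))"
        using N[OF n(2)] C cp[of n] by (intro mult_left_mono) auto
      finally have "((b + 1) * (b + 2) * real n * (real n + 1)) * chain_gf z n
          \<le> ((b + 1) * (b + 2) * real n * (real n + 1)) * (C * comparison b n)" by (simp only: mult_ac)
      then show ?thesis using n assms by (subst (asm) mult_le_cancel_left_pos) auto
    qed
  qed
  with C that show ?thesis by blast
qed

lemma chain_gf_ge_comparison: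
  assumes "b > -1" "z > 0" "(b + 1) * (b + 2) < 2 * z"
  obtains c where "c > 0" "\<And>n. c * comparison b n \<le> chain_gf z n"
proof -
  have "eventually (\<lambda>n. 2 * z * (real n + b + 1) \<ge> (b + 1) * (b + 2) * (real n + 1)) sequentially"
    using assms by real_asymp
  then obtain N where N: "\<And>n. n \<ge> N \<Longrightarrow> 2 * z * (real n + b + 1) \<ge> (b + 1) * (b + 2) * (real n + 1)"
    by (auto simp: eventually_sequentially)
  define c where "c = 1 / (\<Sum>n\<le>N. comparison b n / chain_gf z n)"
  note cp = comparison_pos[OF assms(1)] and gp = chain_gf_pos[OF assms(2)]
  have pos: "0 < comparison b n / chain_gf z n" for n using cp gp by simp
  have C: "(\<Sum>n\<le>N. comparison b n / chain_gf z n) > 0" using pos by (intro sum_pos) auto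
  then have c: "c > 0" unfolding c_def by simp
  have "c * comparison b n \<le> chain_gf z n" for n
  proof (induction n rule: less_induct)
    case (less n)
    show ?case
    proof (cases "n \<le> N")
      case True
      then have "comparison b n / chain_gf z n \<le> 1 / c"
        unfolding c_def using pos
        by (simp, intro member_le_sum) (auto intro: less_imp_le)
      then show ?thesis using gp[of n] c by (simp add: field_simps)
    next
      case False
      then have n: "n > 0" "n \<ge> N" by auto
      have bb: "(b + 1) * (b + 2) > 0" using assms by simp
      have "(c * real n * comparison b n) * ((b + 1) * (b + 2) * (real n + 1))
          \<le> (c * real n * comparison b n) * (2 * z * (real n + b + 1))"
        using N[OF n(2)] c cp[of n] by (intro mult_left_mono) auto
      also have "\<dots> = 2 * z * c * (real n * (real n + b + 1) * comparison b n)" by (simp add: mult_ac)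
      also have "\<dots> = ((b + 1) * (b + 2)) * (2 * z * c * (\<Sum>m<n. (real n - real m) * comparison b m))"
        using weighted_sum_comparison[OF assms(1), of n] by (simp add: mult_ac)
      also have "2 * z * c * (\<Sum>m<n. (real n - real m) * comparison b m)
          = 2 * z * (\<Sum>m<n. (real n - real m) * (c * comparison b m))"
        by (simp add: sum_distrib_left mult_ac)
      also have "((b + 1) * (b + 2)) * \<dots>
          \<le> ((b + 1) * (b + 2)) * (real n * (real n + 1) * chain_gf z n)"
        unfolding chain_gf_rec using less less_imp_le[OF assms(2)] less_imp_le[OF bb]
          by (intro mult_left_mono sum_mono) simp_all
      finally have "((b + 1) * (b + 2) * real n * (real n + 1)) * (c * comparison b n)
          \<le> ((b + 1) * (b + 2) * real n * (real n + 1)) * chain_gf z n"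
        by (simp only: mult_ac)
      then show ?thesis using n assms by (subst (asm) mult_le_cancel_left_pos) auto
    qed
  qed
  with c that show ?thesis by blast
qed

text \<open>For z > 0, the solution a > -1 of (a + 1) (a + 2) = 2 z.\<close>

definition chain_exponent :: "real \<Rightarrow> real" where
  "chain_exponent z = (sqrt (1 + 8 * z) - 3) / 2"

lemma chain_exponent_compare:
  assumes "z > 0" "b > -1"
  shows "(b + 1) * (b + 2) < 2 * z \<longleftrightarrow> b < chain_exponent z"
    and "2 * z < (b + 1) * (b + 2) \<longleftrightarrow> chain_exponent z < b"
proof -
  have sq: "x\<^sup>2 < y\<^sup>2 \<longleftrightarrow> x < y" if "0 \<le> x" "0 \<le> y" for x y :: real
    using that by (auto intro: power2_less_imp_less power_strict_mono)
  have eq: "(2 * b + 3)\<^sup>2 = 1 + 4 * ((b + 1) * (b + 2))" by (simp add: power2_eq_square algebra_simps)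
  have "(b + 1) * (b + 2) < 2 * z \<longleftrightarrow> (2 * b + 3)\<^sup>2 < (sqrt (1 + 8 * z))\<^sup>2"
    unfolding eq using assms by auto
  also have "\<dots> \<longleftrightarrow> 2 * b + 3 < sqrt (1 + 8 * z)"
    using assms by (intro sq) auto
  finally show "(b + 1) * (b + 2) < 2 * z \<longleftrightarrow> b < chain_exponent z"
    by (auto simp: chain_exponent_def field_simps)
  have "2 * z < (b + 1) * (b + 2) \<longleftrightarrow> (sqrt (1 + 8 * z))\<^sup>2 < (2 * b + 3)\<^sup>2"
    unfolding eq using assms by auto
  also have "\<dots> \<longleftrightarrow> sqrt (1 + 8 * z) < 2 * b + 3"
    using assms by (intro sq) auto
  finally show "2 * z < (b + 1) * (b + 2) \<longleftrightarrow> chain_exponent z < b"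
    by (auto simp: chain_exponent_def field_simps)
qed

lemma chain_exponent_gt: "z > 0 \<Longrightarrow> chain_exponent z > -1"
  using real_sqrt_less_mono[of 1 "1 + 8 * z"] by (simp add: chain_exponent_def)

text \<open>Every exponent above the critical one gives an upper bound and every exponent in (-1, critical) gives a
  lower bound, which is all that the logarithmic scale sees.\<close>

lemma chain_gf_growth:
  assumes z: "z > 0"
  shows "(\<lambda>n. ln (chain_gf z n) / ln (real n)) \<longlonglongrightarrow> chain_exponent z"
proof (rule order_tendstoI)
  note gp = chain_gf_pos[OF z]
  have l: "filterlim (\<lambda>n. ln (real n)) at_top sequentially"
    by (intro filterlim_compose[OF ln_at_top] filterlim_real_sequentially)
  have lim: "(\<lambda>n. ln (C * comparison b n) / ln (real n)) \<longlonglongrightarrow> b" if "b > -1" "C > 0" for b C :: real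
  proof -
    have "(\<lambda>n. ln C / ln (real n) + ln (comparison b n) / ln (real n)) \<longlonglongrightarrow> 0 + b"
      by (intro tendsto_add comparison_growth that real_tendsto_divide_at_top[OF tendsto_const l])
    moreover have "ln (C * comparison b n) / ln (real n)
        = ln C / ln (real n) + ln (comparison b n) / ln (real n)" for n
      using that comparison_pos[of b n] by (simp add: ln_mult_pos add_divide_distrib)
    ultimately show ?thesis by simp
  qed
  fix a
  {
    assume a: "a < chain_exponent z"
    define b where "b = (max a (-1) + chain_exponent z) / 2"
    have b: "b > -1" "a < b" "b < chain_exponent z"
      using a chain_exponent_gt[OF z] by (auto simp: b_def)
    obtain c where c: "c > 0" "\<And>n. c * comparison b n \<le> chain_gf z n"
      using chain_gf_ge_comparison[of b z] chain_exponent_compare[OF z b(1)] b z by blast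
    have "eventually (\<lambda>n. a < ln (c * comparison b n) / ln (real n)) sequentially"
      using lim[OF b(1) c(1)] b(2) by (rule order_tendstoD)
    then show "eventually (\<lambda>n. a < ln (chain_gf z n) / ln (real n)) sequentially"
      using eventually_gt_at_top[of 1]
    proof eventually_elim
      case (elim n)
      have "ln (c * comparison b n) / ln (real n) \<le> ln (chain_gf z n) / ln (real n)"
        using c comparison_pos[OF b(1), of n] elim by (intro divide_right_mono) (auto simp: gp)
      with elim show ?case by simp
    qed
  }
  {
    assume a: "chain_exponent z < a"
    define b where "b = (a + chain_exponent z) / 2"
    have b: "b > -1" "b < a" "chain_exponent z < b"
      using a chain_exponent_gt[OF z] by (auto simp: b_def)
    obtain c where c: "c > 0" "\<And>n. chain_gf z n \<le> c * comparison b n"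
      using chain_gf_le_comparison[of b z] chain_exponent_compare[OF z b(1)] b z by blast
    have "eventually (\<lambda>n. ln (c * comparison b n) / ln (real n) < a) sequentially"
      using lim[OF b(1) c(1)] b(2) by (rule order_tendstoD)
    then show "eventually (\<lambda>n. ln (chain_gf z n) / ln (real n) < a) sequentially"
      using eventually_gt_at_top[of 1]
    proof eventually_elim
      case (elim n)
      have "ln (chain_gf z n) / ln (real n) \<le> ln (c * comparison b n) / ln (real n)"
        using c comparison_pos[OF b(1), of n] elim by (intro divide_right_mono) (auto simp: gp)
      with elim show ?case by simp
    qed
  }
qed

section \<open>The generating function of the number of vertices\<close>

lemma sum_Pow_card:
  fixes f :: "nat \<Rightarrow> 'b::comm_semiring_1"
  assumes "finite S"
  shows "(\<Sum>J\<in>Pow S. f (card J)) = (\<Sum>m\<le>card S. of_nat (card S choose m) * f m)"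
proof -
  have "(\<Sum>J\<in>Pow S. f (card J)) = (\<Sum>m\<le>card S. \<Sum>J\<in>{J \<in> Pow S. card J = m}. f (card J))"
    using assms by (intro sum.group[symmetric]) (auto simp: card_mono)
  also have "\<dots> = (\<Sum>m\<le>card S. of_nat (card S choose m) * f m)"
  proof (rule sum.cong)
    fix m
    have "{J \<in> Pow S. card J = m} = {J. J \<subseteq> S \<and> card J = m}" by auto
    then show "(\<Sum>J\<in>{J \<in> Pow S. card J = m}. f (card J)) = of_nat (card S choose m) * f m"
      using assms by (simp add: n_subsets)
  qed simp
  finally show ?thesis .
qed

lemma nn_integral_PiM_affine:
  assumes "prob_space \<mu>" and sets: "sets \<mu> = sets borel"
    and A [measurable]: "A \<in> sets borel" and \<phi> [measurable]: "\<phi> \<in> borel_measurable borel"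
    and scale: "\<And>g. g \<in> borel_measurable borel \<Longrightarrow>
       (\<integral>\<^sup>+q. indicator A q * g q \<partial>\<mu>) = c * (\<integral>\<^sup>+q. g (\<phi> q) \<partial>\<mu>)"
    and "finite J" and "F \<in> borel_measurable (PiM J (\<lambda>_. \<mu>))"
  shows "(\<integral>\<^sup>+\<omega>. (\<Prod>j\<in>J. indicator A (\<omega> j)) * F \<omega> \<partial>PiM J (\<lambda>_. \<mu>))
       = c ^ card J * (\<integral>\<^sup>+\<omega>. F (\<lambda>j\<in>J. \<phi> (\<omega> j)) \<partial>PiM J (\<lambda>_. \<mu>))"
  using assms(6,7)
proof (induction J arbitrary: F rule: finite_induct)
  case empty
  have "(\<integral>\<^sup>+\<omega>. F \<omega> \<partial>PiM {} (\<lambda>_. \<mu>)) = (\<integral>\<^sup>+\<omega>. F (\<lambda>j\<in>{}. \<phi> (\<omega> j)) \<partial>PiM {} (\<lambda>_. \<mu>))"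
    by (rule nn_integral_cong) (simp add: space_PiM restrict_def)
  then show ?case by (simp only: prod.empty card.empty power_0 mult_1)
next
  case (insert j J)
  interpret \<mu>: prob_space \<mu> by fact
  interpret product_prob_space "\<lambda>_. \<mu>" by standard
  note [measurable_cong] = sets
  note [measurable] = insert.prems
  let ?P = "\<lambda>J. PiM J (\<lambda>_. \<mu>)"
  define F' where "F' x = c * (\<integral>\<^sup>+y. F (x(j := \<phi> y)) \<partial>\<mu>)" for x
  have [measurable]: "F' \<in> borel_measurable (?P J)" unfolding F'_def by measurable
  have "(\<integral>\<^sup>+\<omega>. (\<Prod>i\<in>insert j J. indicator A (\<omega> i)) * F \<omega> \<partial>?P (insert j J))
      = (\<integral>\<^sup>+x. \<integral>\<^sup>+y. (\<Prod>i\<in>insert j J. indicator A ((x(j := y)) i)) * F (x(j := y)) \<partial>\<mu> \<partial>?P J)"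
    using insert by (intro product_nn_integral_insert) auto
  also have "\<dots> = (\<integral>\<^sup>+x. (\<Prod>i\<in>J. indicator A (x i)) * F' x \<partial>?P J)"
  proof (rule nn_integral_cong)
    fix x assume x [measurable]: "x \<in> space (?P J)"
    have [measurable]: "(\<lambda>y. F (x(j := y))) \<in> borel_measurable borel"
      by measurable
    have "(\<Prod>i\<in>insert j J. indicator A ((x(j := y)) i)) = (indicator A y * (\<Prod>i\<in>J. indicator A (x i)) :: ennreal)" for y
    proof -
      have "(\<Prod>i\<in>J. indicator A ((x(j := y)) i)) = (\<Prod>i\<in>J. indicator A (x i) :: ennreal)"
        using insert.hyps by (intro prod.cong) auto
      then show ?thesis using insert.hyps by (subst prod.insert) simp_all
    qed
    then have "(\<integral>\<^sup>+y. (\<Prod>i\<in>insert j J. indicator A ((x(j := y)) i)) * F (x(j := y)) \<partial>\<mu>)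
       = (\<integral>\<^sup>+y. (\<Prod>i\<in>J. indicator A (x i)) * (indicator A y * F (x(j := y))) \<partial>\<mu>)"
      by (simp add: mult_ac)
    also have "\<dots> = (\<Prod>i\<in>J. indicator A (x i)) * (\<integral>\<^sup>+y. indicator A y * F (x(j := y)) \<partial>\<mu>)"
      by (rule nn_integral_cmult) measurable
    also have "\<dots> = (\<Prod>i\<in>J. indicator A (x i)) * F' x" unfolding F'_def by (subst scale) auto
    finally show "(\<integral>\<^sup>+y. (\<Prod>i\<in>insert j J. indicator A ((x(j := y)) i)) * F (x(j := y)) \<partial>\<mu>)
       = (\<Prod>i\<in>J. indicator A (x i)) * F' x" .
  qed
  also have "\<dots> = c ^ card J * (\<integral>\<^sup>+x. F' (\<lambda>i\<in>J. \<phi> (x i)) \<partial>?P J)" by (rule insert.IH) measurable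
  also have "(\<integral>\<^sup>+x. F' (\<lambda>i\<in>J. \<phi> (x i)) \<partial>?P J)
      = (\<integral>\<^sup>+x. c * (\<integral>\<^sup>+y. F (\<lambda>i\<in>insert j J. \<phi> ((x(j := y)) i)) \<partial>\<mu>) \<partial>?P J)"
    unfolding F'_def using insert.hyps
    by (intro nn_integral_cong arg_cong[where f = "\<lambda>x. c * x"] arg_cong[where f = F]) (auto simp: fun_eq_iff)
  also have "\<dots> = c * (\<integral>\<^sup>+x. \<integral>\<^sup>+y. F (\<lambda>i\<in>insert j J. \<phi> ((x(j := y)) i)) \<partial>\<mu> \<partial>?P J)"
    by (rule nn_integral_cmult) measurable
  also have "(\<integral>\<^sup>+x. \<integral>\<^sup>+y. F (\<lambda>i\<in>insert j J. \<phi> ((x(j := y)) i)) \<partial>\<mu> \<partial>?P J)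
      = (\<integral>\<^sup>+\<omega>. F (\<lambda>i\<in>insert j J. \<phi> (\<omega> i)) \<partial>?P (insert j J))"
    using insert.hyps by (intro product_nn_integral_insert[symmetric]) auto
  finally show ?case
    unfolding card_insert_disjoint[OF insert.hyps] power_Suc by (simp only: mult_ac)
qed

text \<open>Coordinates on which the integrand depends only through their presence in D can be integrated out.\<close>

lemma nn_integral_PiM_split:
  assumes "prob_space \<mu>" and sets: "sets \<mu> = sets borel"
    and [measurable]: "A \<in> sets borel" "D \<in> sets borel"
    and I: "finite I" "J \<subseteq> I" and F [measurable]: "F \<in> borel_measurable (PiM J (\<lambda>_. \<mu>))"
  shows "(\<integral>\<^sup>+\<omega>. (\<Prod>j\<in>I. if j \<in> J then indicator A (\<omega> j) else indicator D (\<omega> j)) * F (restrict \<omega> J) \<partial>PiM I (\<lambda>_. \<mu>))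
       = emeasure \<mu> D ^ card (I - J) * (\<integral>\<^sup>+\<omega>. (\<Prod>j\<in>J. indicator A (\<omega> j)) * F \<omega> \<partial>PiM J (\<lambda>_. \<mu>))"
proof -
  interpret \<mu>: prob_space \<mu> by fact
  interpret product_prob_space "\<lambda>_. \<mu>" by standard
  note [measurable_cong] = sets
  let ?P = "\<lambda>J. PiM J (\<lambda>_. \<mu>)" and ?K = "I - J"
  let ?f = "\<lambda>\<omega>. (\<Prod>j\<in>I. if j \<in> J then indicator A (\<omega> j) else indicator D (\<omega> j)) * F (restrict \<omega> J)"
  have IJ: "I = J \<union> ?K" "finite J" using I by (auto intro: finite_subset)
  have [measurable]: "(\<lambda>\<omega>. restrict \<omega> J) \<in> measurable (?P I) (?P J)"
    using I by (intro measurable_restrict_subset)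
  have fm: "?f \<in> borel_measurable (?P I)" by measurable
  have "integral\<^sup>N (?P I) ?f = (\<integral>\<^sup>+x. \<integral>\<^sup>+y. ?f (merge J ?K (x, y)) \<partial>?P ?K \<partial>?P J)"
    using product_nn_integral_fold[of J ?K ?f] fm IJ I by (simp add: Un_absorb1)
  also have "\<dots> = (\<integral>\<^sup>+x. \<integral>\<^sup>+y. ((\<Prod>j\<in>J. indicator A (x j)) * F x) * (\<Prod>j\<in>?K. indicator D (y j)) \<partial>?P ?K \<partial>?P J)"
  proof (intro nn_integral_cong)
    fix x y assume x: "x \<in> space (?P J)"
    have "(\<Prod>j\<in>I. if j \<in> J then indicator A (merge J ?K (x, y) j) else indicator D (merge J ?K (x, y) j))
       = (\<Prod>j\<in>J. if j \<in> J then indicator A (merge J ?K (x, y) j) else indicator D (merge J ?K (x, y) j))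
       * (\<Prod>j\<in>?K. if j \<in> J then indicator A (merge J ?K (x, y) j) else (indicator D (merge J ?K (x, y) j) :: ennreal))"
      using I IJ by (subst IJ(1), subst prod.union_disjoint) auto
    also have "\<dots> = (\<Prod>j\<in>J. indicator A (x j)) * (\<Prod>j\<in>?K. indicator D (y j))"
      by (intro arg_cong2[where f = times] prod.cong) (auto simp: merge_def)
    finally have 1: "(\<Prod>j\<in>I. if j \<in> J then indicator A (merge J ?K (x, y) j) else indicator D (merge J ?K (x, y) j))
       = (\<Prod>j\<in>J. indicator A (x j)) * (\<Prod>j\<in>?K. indicator D (y j) :: ennreal)" .
    have 2: "restrict (merge J ?K (x, y)) J = x"
      using x by (auto simp: fun_eq_iff merge_def space_PiM PiE_def extensional_def restrict_def)
    show "?f (merge J ?K (x, y)) = ((\<Prod>j\<in>J. indicator A (x j)) * F x) * (\<Prod>j\<in>?K. indicator D (y j))"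
      unfolding 1 2 by (simp add: mult_ac)
  qed
  also have "\<dots> = (\<integral>\<^sup>+x. ((\<Prod>j\<in>J. indicator A (x j)) * F x) * (\<integral>\<^sup>+y. (\<Prod>j\<in>?K. indicator D (y j)) \<partial>?P ?K) \<partial>?P J)"
    by (intro nn_integral_cong nn_integral_cmult) measurable
  also have "(\<integral>\<^sup>+y. (\<Prod>j\<in>?K. indicator D (y j)) \<partial>?P ?K) = emeasure \<mu> D ^ card ?K"
    using I by (subst product_nn_integral_prod) (auto simp: sets)
  also have "(\<integral>\<^sup>+x. ((\<Prod>j\<in>J. indicator A (x j)) * F x) * emeasure \<mu> D ^ card ?K \<partial>?P J)
     = (\<integral>\<^sup>+x. (\<Prod>j\<in>J. indicator A (x j)) * F x \<partial>?P J) * emeasure \<mu> D ^ card ?K"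
    by (rule nn_integral_multc) measurable
  also have "\<dots> = emeasure \<mu> D ^ card ?K * (\<integral>\<^sup>+x. (\<Prod>j\<in>J. indicator A (x j)) * F x \<partial>?P J)"
    by (rule mult.commute)
  finally show ?thesis .
qed

text \<open>The factor for the j-th point in the indicator of the event that p is the first vertex and that the
  points in its cap are exactly those with index in J.\<close>

definition region_weight :: "real \<times> real \<Rightarrow> 'i set \<Rightarrow> 'i \<Rightarrow> real \<times> real \<Rightarrow> ennreal" where
  "region_weight p J j q = (if j \<in> J then indicator (cap p) q else indicator (beyond p - cap p) q)"

text \<open>Decomposition according to the index i of the first vertex and the set J of indices of points in its
  cap. For a configuration in general position exactly one pair contributes.\<close>

lemma power_num_vertices_first_vertex:
  fixes \<omega> :: "'i \<Rightarrow> real \<times> real"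
  assumes I: "finite I" "I \<noteq> {}" and \<omega>: "\<And>i. i \<in> I \<Longrightarrow> \<omega> i \<in> open_triangle"
    and distinct: "\<And>i j. i \<in> I \<Longrightarrow> j \<in> I \<Longrightarrow> i \<noteq> j \<Longrightarrow> slope (\<omega> i) \<noteq> slope (\<omega> j)"
  shows "ennreal (z ^ num_vertices (convex hull ({(1, 0), (0, 1)} \<union> \<omega> ` I)))
    = (\<Sum>i\<in>I. \<Sum>J\<in>Pow (I - {i}). (\<Prod>j\<in>I - {i}. region_weight (\<omega> i) J j (\<omega> j))
         * ennreal (z * z ^ num_vertices (convex hull ({\<omega> i, (0, 1)} \<union> \<omega> ` J))))"
proof -
  have "\<exists>i\<in>I. \<forall>j\<in>I. slope (\<omega> i) \<le> slope (\<omega> j)"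
    using ex_is_arg_min_if_finite[OF I, of "\<lambda>i. slope (\<omega> i)"] by (auto simp: is_arg_min_linorder)
  then obtain i where i: "i \<in> I" "\<And>j. j \<in> I \<Longrightarrow> slope (\<omega> i) \<le> slope (\<omega> j)" by blast
  have lt: "slope (\<omega> i) < slope (\<omega> j)" if "j \<in> I - {i}" for j
    using i(2)[of j] distinct[of i j] i(1) that by force
  have compare: "slope p * (1 - fst q) < snd q \<longleftrightarrow> slope p < slope q" if "q \<in> open_triangle" for p q
    using slope_bounds[OF that] by (metis mult_less_cancel_right_pos diff_gt_0_iff_gt)
  define J where "J = {j \<in> I - {i}. \<omega> j \<in> cap (\<omega> i)}"
  let ?w = "\<lambda>i J. (\<Prod>j\<in>I - {i}. region_weight (\<omega> i) J j (\<omega> j))"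
  let ?t = "\<lambda>i J. ennreal (z * z ^ num_vertices (convex hull ({\<omega> i, (0, 1)} \<union> \<omega> ` J)))"
  have w0: "?w k L = 0" if "k \<in> I" "k \<noteq> i" for k L
  proof -
    have "\<omega> i \<notin> beyond (\<omega> k)"
    proof -
      have "slope (\<omega> i) < slope (\<omega> k)" using lt that by blast
      moreover have "slope (\<omega> i) * (1 - fst (\<omega> i)) = snd (\<omega> i)" "0 < 1 - fst (\<omega> i)"
        using slope_bounds[OF \<omega>[OF i(1)]] by auto
      ultimately have "snd (\<omega> i) < slope (\<omega> k) * (1 - fst (\<omega> i))"
        by (metis mult_strict_right_mono)
      then show ?thesis by (simp add: beyond_def)
    qed
    then have "region_weight (\<omega> k) L i (\<omega> i) = 0"
      using cap_subset_beyond[of "\<omega> k"] by (auto simp: region_weight_def indicator_def)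
    then show ?thesis using I that i(1) by (intro prod_zero) auto
  qed
  have w1: "?w i J = 1"
  proof (rule prod.neutral, rule ballI)
    fix j assume j: "j \<in> I - {i}"
    have "slope (\<omega> i) * (1 - fst (\<omega> j)) < snd (\<omega> j)" using compare[of "\<omega> j" "\<omega> i"] \<omega> lt j by simp
    then have "\<omega> j \<in> beyond (\<omega> i)" by (simp add: beyond_def)
    then show "region_weight (\<omega> i) J j (\<omega> j) = 1" using j by (simp add: region_weight_def J_def)
  qed
  have w2: "?w i L = 0" if L: "L \<in> Pow (I - {i})" "L \<noteq> J" for L
  proof -
    obtain j where j: "j \<in> I - {i}" "(j \<in> L) \<noteq> (\<omega> j \<in> cap (\<omega> i))" using L by (auto simp: J_def)
    then have "region_weight (\<omega> i) L j (\<omega> j) = 0" by (auto simp: region_weight_def indicator_def)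
    then show ?thesis using I j by (intro prod_zero) auto
  qed
  have "(\<Sum>i\<in>I. \<Sum>J\<in>Pow (I - {i}). ?w i J * ?t i J) = (\<Sum>i\<in>{i}. \<Sum>J\<in>Pow (I - {i}). ?w i J * ?t i J)"
    using I i(1) w0 by (intro sum.mono_neutral_right) auto
  also have "\<dots> = (\<Sum>J\<in>Pow (I - {i}). ?w i J * ?t i J)" by simp
  also have "\<dots> = (\<Sum>J\<in>{J}. ?w i J * ?t i J)"
  proof (rule sum.mono_neutral_right)
    show "\<forall>L\<in>Pow (I - {i}) - {J}. ?w i L * ?t i L = 0" using w2 by (metis Diff_iff insertI1 mult_zero_left)
  qed (use I in \<open>auto simp: J_def\<close>)
  also have "\<dots> = ?t i J" by (simp only: w1 sum.insert finite.emptyI sum.empty empty_iff not_False_eq_True) simp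
  also have "\<dots> = ennreal (z ^ num_vertices (convex hull ({(1, 0), (0, 1)} \<union> \<omega> ` I)))"
  proof -
    have "num_vertices (convex hull ({(1, 0), (0, 1)} \<union> insert (\<omega> i) (\<omega> ` (I - {i}))))
       = Suc (num_vertices (convex hull ({\<omega> i, (0, 1)} \<union> (\<omega> ` (I - {i}) \<inter> cap (\<omega> i)))))"
    proof (rule num_vertices_split)
      show "\<omega> i \<in> open_triangle" "finite (\<omega> ` (I - {i}))" "\<omega> ` (I - {i}) \<subseteq> open_triangle"
        using I i(1) \<omega> by auto
      fix q assume "q \<in> \<omega> ` (I - {i})"
      then obtain j where "j \<in> I - {i}" "q = \<omega> j" by blast
      then show "slope (\<omega> i) * (1 - fst q) < snd q" using compare[of q "\<omega> i"] \<omega> lt by simp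
    qed
    moreover have "insert (\<omega> i) (\<omega> ` (I - {i})) = \<omega> ` I" using i(1) by auto
    moreover have "\<omega> ` (I - {i}) \<inter> cap (\<omega> i) = \<omega> ` J" by (auto simp: J_def)
    ultimately show ?thesis by simp
  qed
  finally show ?thesis by simp
qed

lemma measurable_indicator_cap [measurable (raw)]:
  assumes [measurable]: "f \<in> borel_measurable M" "g \<in> borel_measurable M"
  shows "(\<lambda>x. indicator (cap (f x)) (g x) :: ennreal) \<in> borel_measurable M"
    and "(\<lambda>x. indicator (beyond (f x) - cap (f x)) (g x) :: ennreal) \<in> borel_measurable M"
  unfolding cap_def beyond_def slope_def indicator_def by simp_all measurable

lemma measurable_region_weight [measurable (raw)]:
  assumes [measurable]: "f \<in> borel_measurable M" "g \<in> borel_measurable M"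
  shows "(\<lambda>x. region_weight (f x) J j (g x)) \<in> borel_measurable M"
  unfolding region_weight_def by measurable

lemma measurable_power_num_vertices:
  fixes Z :: "'k \<Rightarrow> 'b \<Rightarrow> 'a::euclidean_space"
  assumes "finite J" "\<And>j. j \<in> J \<Longrightarrow> Z j \<in> borel_measurable M"
    and "P \<in> borel_measurable M" "Q \<in> borel_measurable M"
  shows "(\<lambda>\<omega>. ennreal (c * z ^ num_vertices (convex hull ({P \<omega>, Q \<omega>} \<union> (\<lambda>j. Z j \<omega>) ` J)))) \<in> borel_measurable M"
proof -
  have "(\<lambda>n. ennreal (c * z ^ n)) \<in> borel_measurable (count_space UNIV)" by simp
  from measurable_compose[OF measurable_num_vertices_with_base[OF assms] this] show ?thesis .
qed

abbreviation points_law :: "'i set \<Rightarrow> ('i \<Rightarrow> real \<times> real) measure" where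
  "points_law I \<equiv> PiM I (\<lambda>_. triangle_law)"

text \<open>The probability generating function of the number of vertices. The index set is arbitrary, since
  discarding points leaves an arbitrary set of indices.\<close>

definition vertex_gf :: "real \<Rightarrow> 'i set \<Rightarrow> ennreal" where
  "vertex_gf z I = (\<integral>\<^sup>+\<omega>. ennreal (z ^ num_vertices (convex hull ({(1, 0), (0, 1)} \<union> \<omega> ` I))) \<partial>points_law I)"

lemma AE_points_law:
  fixes I :: "'i set"
  assumes I: "finite I"
  shows "AE \<omega> in points_law I. (\<forall>i\<in>I. \<omega> i \<in> open_triangle) \<and>
     (\<forall>i\<in>I. \<forall>j\<in>I. i \<noteq> j \<longrightarrow> slope (\<omega> i) \<noteq> slope (\<omega> j))"
proof -
  interpret T: prob_space triangle_law by (rule prob_space_triangle_law)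
  interpret product_prob_space "\<lambda>_::'i. triangle_law" by standard
  have [measurable]: "slope \<in> borel_measurable borel" unfolding slope_def [abs_def] by measurable
  have "AE \<omega> in points_law I. slope (\<omega> i) \<noteq> slope (\<omega> j)" if ij: "i \<in> I" "j \<in> I" "i \<noteq> j" for i j
  proof -
    define I' where "I' = I - {i}"
    have I': "I = insert i I'" "i \<notin> I'" "finite I'" "j \<in> I'" using ij I by (auto simp: I'_def)
    let ?S = "{\<omega> \<in> space (points_law I). slope (\<omega> i) = slope (\<omega> j)}"
    have [measurable]: "?S \<in> sets (points_law I)" using ij by measurable
    have "emeasure (points_law I) ?S = (\<integral>\<^sup>+\<omega>. indicator ?S \<omega> \<partial>points_law (insert i I'))"
      unfolding I'(1)[symmetric] by (subst nn_integral_indicator) auto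
    also have "\<dots> = (\<integral>\<^sup>+x. \<integral>\<^sup>+y. indicator ?S (x(i := y)) \<partial>triangle_law \<partial>points_law I')"
      using I' by (intro product_nn_integral_insert) auto
    also have "\<dots> = (\<integral>\<^sup>+x. 0 \<partial>points_law I')"
    proof (rule nn_integral_cong)
      fix x
      have "(\<integral>\<^sup>+y. indicator ?S (x(i := y)) \<partial>triangle_law) = (\<integral>\<^sup>+y. 0 \<partial>triangle_law)"
        using AE_triangle_law_slope[of "slope (x j)"]
        by (intro nn_integral_cong_AE, eventually_elim) (use ij in \<open>auto simp: indicator_def\<close>)
      then show "(\<integral>\<^sup>+y. indicator ?S (x(i := y)) \<partial>triangle_law) = 0" by simp
    qed
    finally have "emeasure (points_law I) ?S = 0" by simp
    then show ?thesis by (intro AE_I[where N = ?S]) auto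
  qed
  moreover have "AE \<omega> in points_law I. \<omega> i \<in> open_triangle" if "i \<in> I" for i
    using that by (intro AE_component AE_triangle_law_open)
  ultimately show ?thesis using I by (auto simp: AE_finite_all)
qed

text \<open>Given the first vertex p, the points outside its cap are integrated out, and the points in the cap are
  transported to the unit triangle, where they again form a uniform sample. Hence the contribution is the
  probability of the pair (i, J) times the generating function for J, with a further factor z for the vertex p.\<close>

lemma nn_integral_first_vertex_term:
  fixes I :: "'i set"
  assumes z: "z \<ge> 0" and I: "finite I" "i \<in> I" "J \<subseteq> I - {i}"
  shows "(\<integral>\<^sup>+\<omega>. (\<Prod>j\<in>I - {i}. region_weight (\<omega> i) J j (\<omega> j))
         * ennreal (z * z ^ num_vertices (convex hull ({\<omega> i, (0, 1)} \<union> \<omega> ` J))) \<partial>points_law I)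
    = ennreal (2 * fact (card I - card J) * fact (card J) / (real (card I) * fact (card I + 1)))
      * (ennreal z * vertex_gf z J)"
proof -
  interpret T: prob_space triangle_law by (rule prob_space_triangle_law)
  interpret product_prob_space "\<lambda>_::'i. triangle_law" by standard
  define I' where "I' = I - {i}"
  have I': "I = insert i I'" "i \<notin> I'" "finite I'" "J \<subseteq> I'" "finite J" "i \<notin> J"
    using I by (auto simp: I'_def intro: finite_subset)
  have card: "card I = Suc (card I')" "card J + card (I' - J) = card I'"
    using I' by (auto simp: card_Diff_subset card_mono)
  let ?t = "\<lambda>p \<omega>. ennreal (z * z ^ num_vertices (convex hull ({p, (0, 1)} \<union> \<omega> ` J)))"
  let ?f = "\<lambda>\<omega>. (\<Prod>j\<in>I'. region_weight (\<omega> i) J j (\<omega> j)) * ?t (\<omega> i) \<omega>"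
  have "(\<lambda>\<omega>. ?t (\<omega> i) \<omega>) \<in> borel_measurable (points_law (insert i I'))"
    using I' by (intro measurable_power_num_vertices) auto
  then have fm: "?f \<in> borel_measurable (points_law (insert i I'))" by measurable
  have "(\<integral>\<^sup>+\<omega>. ?f \<omega> \<partial>points_law I) = (\<integral>\<^sup>+p. \<integral>\<^sup>+x. ?f (x(i := p)) \<partial>points_law I' \<partial>triangle_law)"
    unfolding I'(1) using I' fm by (intro product_nn_integral_insert_rev) auto
  also have "\<dots> = (\<integral>\<^sup>+p. ennreal (((1 - fst p) * (1 - slope p)) ^ card (I' - J) * (fst p * (1 - slope p)) ^ card J)
        * (ennreal z * vertex_gf z J) \<partial>triangle_law)"
  proof (rule nn_integral_cong_AE, use AE_triangle_law_open in eventually_elim)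
    fix p assume p: "p \<in> open_triangle"
    have tm: "?t p \<in> borel_measurable (points_law J)"
      using I' by (intro measurable_power_num_vertices) auto
    have "?f (x(i := p)) = (\<Prod>j\<in>I'. if j \<in> J then indicator (cap p) (x j) else indicator (beyond p - cap p) (x j)) * ?t p (restrict x J)" for x
    proof -
      have "(x(i := p)) ` J = restrict x J ` J" using I' by (auto simp: image_def)
      moreover have "(\<Prod>j\<in>I'. region_weight p J j ((x(i := p)) j))
          = (\<Prod>j\<in>I'. if j \<in> J then indicator (cap p) (x j) else indicator (beyond p - cap p) (x j))"
        using I' by (intro prod.cong) (auto simp: region_weight_def)
      ultimately show ?thesis by simp
    qed
    then have "(\<integral>\<^sup>+x. ?f (x(i := p)) \<partial>points_law I')
        = (\<integral>\<^sup>+\<omega>. (\<Prod>j\<in>I'. if j \<in> J then indicator (cap p) (\<omega> j) else indicator (beyond p - cap p) (\<omega> j)) * ?t p (restrict \<omega> J) \<partial>points_law I')"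
      by simp
    also have "\<dots> = emeasure triangle_law (beyond p - cap p) ^ card (I' - J)
        * (\<integral>\<^sup>+\<omega>. (\<Prod>j\<in>J. indicator (cap p) (\<omega> j)) * ?t p \<omega> \<partial>points_law J)"
      using I' tm by (intro nn_integral_PiM_split T.prob_space_axioms) auto
    also have "(\<integral>\<^sup>+\<omega>. (\<Prod>j\<in>J. indicator (cap p) (\<omega> j)) * ?t p \<omega> \<partial>points_law J)
        = ennreal (fst p * (1 - slope p)) ^ card J * (\<integral>\<^sup>+\<omega>. ?t p (\<lambda>j\<in>J. cap_map p (\<omega> j)) \<partial>points_law J)"
      using I' tm by (intro nn_integral_PiM_affine T.prob_space_axioms nn_integral_cap[OF p]) auto
    also have "(\<integral>\<^sup>+\<omega>. ?t p (\<lambda>j\<in>J. cap_map p (\<omega> j)) \<partial>points_law J) = ennreal z * vertex_gf z J"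
    proof -
      have "(\<lambda>j\<in>J. cap_map p (\<omega> j)) ` J = cap_map p ` \<omega> ` J" for \<omega> by (auto simp: image_image)
      then have "?t p (\<lambda>j\<in>J. cap_map p (\<omega> j))
          = ennreal z * ennreal (1 * z ^ num_vertices (convex hull ({(1, 0), (0, 1)} \<union> \<omega> ` J)))" for \<omega>
        using z num_vertices_cap_map[OF p, of "\<omega> ` J"] by (simp add: ennreal_mult)
      moreover have "(\<lambda>\<omega>. ennreal (1 * z ^ num_vertices (convex hull ({(1, 0), (0, 1)} \<union> \<omega> ` J)))) \<in> borel_measurable (points_law J)"
        using I' by (intro measurable_power_num_vertices) auto
      ultimately show ?thesis unfolding vertex_gf_def by (simp add: nn_integral_cmult)
    qed
    also have "emeasure triangle_law (beyond p - cap p) ^ card (I' - J) * (ennreal (fst p * (1 - slope p)) ^ card J * (ennreal z * vertex_gf z J))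
        = ennreal (((1 - fst p) * (1 - slope p)) ^ card (I' - J) * (fst p * (1 - slope p)) ^ card J) * (ennreal z * vertex_gf z J)"
    proof -
      have "ennreal a ^ k * (ennreal b ^ m * x) = ennreal (a ^ k * b ^ m) * x" if "0 \<le> a" "0 \<le> b" for a b k m x
        using that by (simp add: ennreal_power mult.assoc ennreal_mult)
      moreover have "0 \<le> (1 - fst p) * (1 - slope p)" "0 \<le> fst p * (1 - slope p)"
        using slope_bounds[OF p] by auto
      ultimately show ?thesis unfolding emeasure_beyond_diff_cap[OF p] by blast
    qed
    finally show "(\<integral>\<^sup>+x. ?f (x(i := p)) \<partial>points_law I')
      = ennreal (((1 - fst p) * (1 - slope p)) ^ card (I' - J) * (fst p * (1 - slope p)) ^ card J) * (ennreal z * vertex_gf z J)" .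
  qed
  also have "\<dots> = ennreal (2 * fact (card (I' - J) + 1) * fact (card J) / ((real (card I') + 1) * fact (card I' + 2)))
      * (ennreal z * vertex_gf z J)"
  proof -
    have [measurable]: "slope \<in> borel_measurable borel" unfolding slope_def [abs_def] by measurable
    show ?thesis
      by (subst nn_integral_multc) (simp_all only: nn_integral_split_weight[OF card(2)], measurable)
  qed
  also have "card (I' - J) + 1 = card I - card J" using card by auto
  also have "real (card I') + 1 = real (card I)" using card by simp
  also have "card I' + 2 = card I + 1" using card by simp
  finally show ?thesis unfolding I'_def .
qed

text \<open>Summing the contributions over all pairs (i, J) gives exactly the recursion that defines the
  function on the right. The factor z^2 stands for the two fixed vertices.\<close>

proposition vertex_gf_eq:
  fixes I :: "'i set"
  assumes z: "z \<ge> 0" and "finite I"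
  shows "vertex_gf z I = ennreal (z\<^sup>2 * chain_gf z (card I))"
  using assms(2)
proof (induction "card I" arbitrary: I rule: less_induct)
  case (less I)
  interpret T: prob_space triangle_law by (rule prob_space_triangle_law)
  interpret product_prob_space "\<lambda>_::'i. triangle_law" by standard
  have gf0: "chain_gf z m \<ge> 0" for m
    using z
  proof (induction m rule: less_induct)
    case (less m)
    then show ?case by (subst chain_gf.simps) (auto intro!: mult_nonneg_nonneg sum_nonneg divide_nonneg_nonneg)
  qed
  show ?case
  proof (cases "I = {}")
    case True
    have "num_vertices (convex hull {(1, 0), (0, 1) :: real \<times> real}) = 2"
    proof -
      have "{v. v = (1, 0) \<or> v = (0, 1 :: real)} = {(1 :: real, 0), (0, 1)}" by auto
      then show ?thesis unfolding num_vertices_def extreme_point_of_convex_hull_2 by simp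
    qed
    moreover have "emeasure (points_law ({} :: 'i set)) (space (points_law {})) = 1"
      by (rule prob_space.emeasure_space_1[OF prob_space_PiM[OF prob_space_triangle_law]])
    ultimately show ?thesis unfolding vertex_gf_def True by simp
  next
    case False
    define N where "N = card I - 1"
    have N: "card I = Suc N" using False less.prems by (simp add: N_def card_gt_0_iff)
    let ?W = "\<lambda>i J \<omega>. (\<Prod>j\<in>I - {i}. region_weight (\<omega> i) J j (\<omega> j))
         * ennreal (z * z ^ num_vertices (convex hull ({\<omega> i, (0, 1)} \<union> \<omega> ` J)))"
    have Wm: "?W i J \<in> borel_measurable (points_law I)" if "i \<in> I" "J \<in> Pow (I - {i})" for i J
    proof -
      have [measurable]: "(\<lambda>\<omega>. ennreal (z * z ^ num_vertices (convex hull ({\<omega> i, (0, 1)} \<union> \<omega> ` J)))) \<in> borel_measurable (points_law I)"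
        using that less.prems by (intro measurable_power_num_vertices) (auto intro: finite_subset)
      show ?thesis using that by measurable
    qed
    define h where "h m = 2 * fact (card I - m) * fact m / (real (card I) * fact (card I + 1)) * (z * (z\<^sup>2 * chain_gf z m))" for m
    have h0: "h m \<ge> 0" for m unfolding h_def using z gf0 by (intro mult_nonneg_nonneg divide_nonneg_nonneg) auto
    have "vertex_gf z I = (\<integral>\<^sup>+\<omega>. (\<Sum>i\<in>I. \<Sum>J\<in>Pow (I - {i}). ?W i J \<omega>) \<partial>points_law I)"
      unfolding vertex_gf_def
      by (rule nn_integral_cong_AE, use AE_points_law[OF less.prems] in eventually_elim)
         (intro power_num_vertices_first_vertex less.prems False, auto)
    also have "\<dots> = (\<Sum>i\<in>I. \<Sum>J\<in>Pow (I - {i}). \<integral>\<^sup>+\<omega>. ?W i J \<omega> \<partial>points_law I)"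
      using Wm by (subst nn_integral_sum, force intro!: borel_measurable_sum,
          intro sum.cong refl nn_integral_sum) auto
    also have "\<dots> = (\<Sum>i\<in>I. \<Sum>J\<in>Pow (I - {i}). ennreal (h (card J)))"
    proof (intro sum.cong refl)
      fix i J assume i: "i \<in> I" and J: "J \<in> Pow (I - {i})"
      have J': "finite J" "card J < card I"
        using i J less.prems by (auto intro: finite_subset psubset_card_mono)
      have "(\<integral>\<^sup>+\<omega>. ?W i J \<omega> \<partial>points_law I)
        = ennreal (2 * fact (card I - card J) * fact (card J) / (real (card I) * fact (card I + 1))) * (ennreal z * vertex_gf z J)"
        using i J less.prems z by (intro nn_integral_first_vertex_term) auto
      also have "vertex_gf z J = ennreal (z\<^sup>2 * chain_gf z (card J))" using J' by (intro less.hyps)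
      finally show "(\<integral>\<^sup>+\<omega>. ?W i J \<omega> \<partial>points_law I) = ennreal (h (card J))"
        using z gf0 by (simp add: h_def flip: ennreal_mult)
    qed
    also have "\<dots> = ennreal (\<Sum>i\<in>I. \<Sum>J\<in>Pow (I - {i}). h (card J))"
      using h0 by (simp add: sum_nonneg)
    also have "(\<Sum>i\<in>I. \<Sum>J\<in>Pow (I - {i}). h (card J)) = (\<Sum>i\<in>I. \<Sum>m\<le>N. real (N choose m) * h m)"
      using less.prems N by (intro sum.cong refl) (simp add: sum_Pow_card)
    also have "\<dots> = (real N + 1) * (\<Sum>m\<le>N. real (N choose m) * h m)" using N by simp
    also have "\<dots> = z\<^sup>2 * chain_gf z (card I)"
    proof -
      have "(real N + 1) * (real (N choose m) * h m)
         = z ^ 2 * (2 * z / ((real N + 1) * (real N + 2)) * ((real N + 1 - real m) * chain_gf z m))" if "m \<le> N" for m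
      proof -
        have 1: "(fact (Suc N - m) :: real) = (real N + 1 - real m) * fact (N - m)"
          using that by (simp add: Suc_diff_le of_nat_diff)
        have 2: "(fact (Suc N + 1) :: real) = (real N + 2) * ((real N + 1) * fact N)" by (simp add: algebra_simps)
        have 3: "real (N choose m) = fact N / (fact m * fact (N - m))" using that by (rule binomial_fact)
        show ?thesis unfolding h_def N 1 2 3 by (simp add: divide_simps power2_eq_square)
      qed
      then have "(real N + 1) * (\<Sum>m\<le>N. real (N choose m) * h m)
         = z ^ 2 * (2 * z / ((real N + 1) * (real N + 2)) * (\<Sum>m\<le>N. (real N + 1 - real m) * chain_gf z m))"
        by (simp add: sum_distrib_left)
      also have "\<dots> = z\<^sup>2 * chain_gf z (card I)"
        unfolding N by (subst (2) chain_gf.simps) (simp add: lessThan_Suc_atMost add_ac)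
      finally show ?thesis .
    qed
    finally show ?thesis .
  qed
qed

section \<open>Large deviations from cumulant generating functions\<close>

text \<open>The hypotheses of the Gartner-Ellis theorem on the line, with a limit that is finite everywhere.\<close>

locale log_mgf_limit =
  fixes M :: "nat \<Rightarrow> 'a measure" and Y :: "nat \<Rightarrow> 'a \<Rightarrow> real"
    and s :: "nat \<Rightarrow> real" and \<Lambda> :: "real \<Rightarrow> real"
  assumes prob: "\<And>n. prob_space (M n)"
    and rv [measurable]: "\<And>n. Y n \<in> borel_measurable (M n)"
    and integrable_exp: "\<And>n \<theta>. integrable (M n) (\<lambda>\<omega>. exp (\<theta> * (s n * Y n \<omega>)))"
    and speed: "filterlim s at_top sequentially"
    and log_mgf: "\<And>\<theta>. (\<lambda>n. ln (\<integral>\<omega>. exp (\<theta> * (s n * Y n \<omega>)) \<partial>M n) / s n) \<longlonglongrightarrow> \<Lambda> \<theta>"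
begin

definition mgf :: "nat \<Rightarrow> real \<Rightarrow> real" where
  "mgf n \<theta> = (\<integral>\<omega>. exp (\<theta> * (s n * Y n \<omega>)) \<partial>M n)"

lemma speed_pos: "eventually (\<lambda>n. s n > 0) sequentially"
  using speed by (simp add: filterlim_at_top_dense)

lemma mgf_pos: "mgf n \<theta> > 0"
proof -
  interpret prob_space "M n" by (rule prob)
  have "(\<integral>\<omega>. 0 \<partial>M n) < mgf n \<theta>"
    unfolding mgf_def
    by (intro integral_less_AE_space integrable_exp) (auto simp: emeasure_space_1)
  then show ?thesis by simp
qed

lemma mgf_le:
  assumes "\<Lambda> \<theta> < a"
  shows "eventually (\<lambda>n. mgf n \<theta> \<le> exp (s n * a)) sequentially"
  using order_tendstoD(2)[OF log_mgf assms] speed_pos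
proof eventually_elim
  case (elim n)
  then have "ln (mgf n \<theta>) < s n * a" by (simp add: mgf_def field_simps)
  then show ?case using mgf_pos[of n \<theta>] by (metis exp_le_cancel_iff exp_ln less_imp_le)
qed

lemma mgf_ge:
  assumes "a < \<Lambda> \<theta>"
  shows "eventually (\<lambda>n. exp (s n * a) \<le> mgf n \<theta>) sequentially"
  using order_tendstoD(1)[OF log_mgf assms] speed_pos
proof eventually_elim
  case (elim n)
  then have "s n * a < ln (mgf n \<theta>)" by (simp add: mgf_def field_simps)
  then show ?case using mgf_pos[of n \<theta>] by (metis exp_le_cancel_iff exp_ln less_imp_le)
qed

text \<open>The sign of \<eta> decides which tail the event describes, so that one statement covers both. The tilt
  \<theta> = 0 gives the usual exponential Markov inequality.\<close>

lemma tilted_chernoff: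
  assumes "s n \<ge> 0"
  shows "(\<integral>\<omega>. exp (\<theta> * (s n * Y n \<omega>)) * indicator {\<omega>. \<eta> * b \<le> \<eta> * Y n \<omega>} \<omega> \<partial>M n)
           \<le> exp (- (\<eta> * (s n * b))) * mgf n (\<theta> + \<eta>)"
proof -
  have "(\<integral>\<omega>. exp (\<theta> * (s n * Y n \<omega>)) * indicator {\<omega>. \<eta> * b \<le> \<eta> * Y n \<omega>} \<omega> \<partial>M n)
      \<le> (\<integral>\<omega>. exp (- (\<eta> * (s n * b))) * exp ((\<theta> + \<eta>) * (s n * Y n \<omega>)) \<partial>M n)"
  proof (rule integral_mono')
    show "integrable (M n) (\<lambda>\<omega>. exp (- (\<eta> * (s n * b))) * exp ((\<theta> + \<eta>) * (s n * Y n \<omega>)))"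
      by (intro integrable_mult_right integrable_exp)
    fix \<omega>
    show "exp (\<theta> * (s n * Y n \<omega>)) * indicator {\<omega>. \<eta> * b \<le> \<eta> * Y n \<omega>} \<omega>
       \<le> exp (- (\<eta> * (s n * b))) * exp ((\<theta> + \<eta>) * (s n * Y n \<omega>))"
    proof (cases "\<eta> * b \<le> \<eta> * Y n \<omega>")
      case True
      then have "s n * (\<eta> * b) \<le> s n * (\<eta> * Y n \<omega>)" using assms by (rule mult_left_mono)
      then show ?thesis using True by (simp add: mult_exp_exp algebra_simps)
    qed simp
  qed simp
  then show ?thesis by (simp add: mgf_def)
qed

lemma tilted_tail:
  assumes "\<Lambda> (\<theta> + \<eta>) - \<eta> * b < a"
  shows "eventually (\<lambda>n. (\<integral>\<omega>. exp (\<theta> * (s n * Y n \<omega>)) * indicator {\<omega>. \<eta> * b \<le> \<eta> * Y n \<omega>} \<omega> \<partial>M n)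
           \<le> exp (s n * a)) sequentially"
proof -
  have "\<Lambda> (\<theta> + \<eta>) < a + \<eta> * b" using assms by simp
  from mgf_le[OF this] speed_pos show ?thesis
  proof eventually_elim
    case (elim n)
    have "(\<integral>\<omega>. exp (\<theta> * (s n * Y n \<omega>)) * indicator {\<omega>. \<eta> * b \<le> \<eta> * Y n \<omega>} \<omega> \<partial>M n)
        \<le> exp (- (\<eta> * (s n * b))) * mgf n (\<theta> + \<eta>)" using elim by (intro tilted_chernoff) simp
    also have "\<dots> \<le> exp (- (\<eta> * (s n * b))) * exp (s n * (a + \<eta> * b))" using elim by simp
    also have "\<dots> = exp (s n * a)" by (simp add: mult_exp_exp algebra_simps)
    finally show ?case .
  qed
qed

lemma chernoff:
  assumes "c < \<eta> * b - \<Lambda> \<eta>"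
  shows "eventually (\<lambda>n. measure (M n) {\<omega> \<in> space (M n). \<eta> * b \<le> \<eta> * Y n \<omega>} \<le> exp (- (s n * c))) sequentially"
proof -
  have "\<Lambda> (0 + \<eta>) - \<eta> * b < - c" using assms by simp
  from tilted_tail[OF this] show ?thesis
  proof eventually_elim
    case (elim n)
    have "measure (M n) {\<omega> \<in> space (M n). \<eta> * b \<le> \<eta> * Y n \<omega>}
        = (\<integral>\<omega>. exp (0 * (s n * Y n \<omega>)) * indicator {\<omega>. \<eta> * b \<le> \<eta> * Y n \<omega>} \<omega> \<partial>M n)"
      by (simp flip: integral_indicator add: Int_def conj_commute)
    with elim show ?case by simp
  qed
qed

text \<open>Tilting by \<theta> moves the mean to x, the derivative of \<Lambda> at \<theta>: under the tilted law both tails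
  outside (x - d, x + d) are exponentially small by the tilted Chernoff bound, since \<Lambda> lies close to its
  tangent at \<theta>. So the window carries nearly all of the tilted mass, and undoing the tilt costs the factor
  exp(-s(\<theta> x - \<Lambda> \<theta>)) up to the width of the window.\<close>

lemma local_lower_bound:
  assumes deriv: "(\<Lambda> has_real_derivative x) (at \<theta>)" and c: "\<theta> * x - \<Lambda> \<theta> < c" and \<delta>: "\<delta> > 0"
  shows "eventually (\<lambda>n. exp (- (s n * c)) \<le> measure (M n) {\<omega> \<in> space (M n). \<bar>Y n \<omega> - x\<bar> < \<delta>}) sequentially"
proof -
  define g where "g = c - (\<theta> * x - \<Lambda> \<theta>)"
  have g: "g > 0" using c by (simp add: g_def)
  \<comment> \<open>A window this narrow makes the error from the variation of the tilt at most half of the gap g.\<close>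
  define d where "d = min \<delta> (g / (2 * (\<bar>\<theta>\<bar> + 1)))"
  have d: "0 < d" "d \<le> \<delta>" using \<delta> g by (auto simp: d_def)
  have "\<bar>\<theta>\<bar> * d \<le> (\<bar>\<theta>\<bar> + 1) * (g / (2 * (\<bar>\<theta>\<bar> + 1)))"
    using d by (intro mult_mono) (auto simp: d_def)
  also have "\<dots> = g / 2"
    using mult_divide_mult_cancel_left[of "\<bar>\<theta>\<bar> + 1" g 2] by (simp add: mult_ac)
  finally have d\<theta>: "\<bar>\<theta>\<bar> * d \<le> g / 2" .
  have D1: "((\<lambda>y. y * (x + d) - \<Lambda> y) has_real_derivative d) (at \<theta>)"
    by (auto intro!: derivative_eq_intros deriv)
  obtain h1 where h1: "h1 > 0" "\<Lambda> (\<theta> + h1) - h1 * (x + d) < \<Lambda> \<theta>"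
  proof -
    assume *: thesis if "h1 > 0" "\<Lambda> (\<theta> + h1) - h1 * (x + d) < \<Lambda> \<theta>" for h1
    obtain e where e: "e > 0" "\<And>h. h > 0 \<Longrightarrow> h < e \<Longrightarrow> \<theta> * (x + d) - \<Lambda> \<theta> < (\<theta> + h) * (x + d) - \<Lambda> (\<theta> + h)"
      using DERIV_pos_inc_right[OF D1 d(1)] by blast
    show thesis using e(1) e(2)[of "e / 2"] by (intro *[of "e / 2"]) (auto simp: algebra_simps)
  qed
  have D2: "((\<lambda>y. y * (x - d) - \<Lambda> y) has_real_derivative -d) (at \<theta>)"
    by (auto intro!: derivative_eq_intros deriv)
  obtain h2 where h2: "h2 > 0" "\<Lambda> (\<theta> + - h2) - - h2 * (x - d) < \<Lambda> \<theta>"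
  proof -
    assume *: thesis if "h2 > 0" "\<Lambda> (\<theta> + - h2) - - h2 * (x - d) < \<Lambda> \<theta>" for h2
    obtain e where e: "e > 0" "\<And>h. h > 0 \<Longrightarrow> h < e \<Longrightarrow> \<theta> * (x - d) - \<Lambda> \<theta> < (\<theta> - h) * (x - d) - \<Lambda> (\<theta> - h)"
      using DERIV_neg_dec_left[OF D2] d(1) by auto
    show thesis using e(1) e(2)[of "e / 2"] by (intro *[of "e / 2"]) (auto simp: algebra_simps)
  qed
  define e1 where "e1 = min (\<Lambda> \<theta> - (\<Lambda> (\<theta> + h1) - h1 * (x + d))) (\<Lambda> \<theta> - (\<Lambda> (\<theta> + - h2) - - h2 * (x - d)))"
  have e1: "e1 > 0" using h1 h2 by (simp add: e1_def)
  define e where "e = min (e1 / 4) (g / 4)"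
  have e: "e > 0" "3 * e < e1" "2 * e \<le> g / 2" using e1 g by (auto simp: e_def)
  have T1: "\<Lambda> (\<theta> + h1) - h1 * (x + d) < \<Lambda> \<theta> - 3 * e" and T2: "\<Lambda> (\<theta> + - h2) - - h2 * (x - d) < \<Lambda> \<theta> - 3 * e"
    using e(2) by (auto simp: e1_def)
  have big: "eventually (\<lambda>n. s n \<ge> ln 4 / e) sequentially"
    using speed by (simp add: filterlim_at_top)
  have "\<Lambda> \<theta> - e < \<Lambda> \<theta>" using e by simp
  from mgf_ge[OF this] tilted_tail[OF T1] tilted_tail[OF T2] big speed_pos
  show ?thesis
  proof eventually_elim
    case (elim n)
    interpret prob_space "M n" by (rule prob)
    let ?E = "\<lambda>\<omega>. exp (\<theta> * (s n * Y n \<omega>))"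
    define P where "P = measure (M n) {\<omega> \<in> space (M n). \<bar>Y n \<omega> - x\<bar> < d}"
    let ?a = "\<lambda>\<omega>. exp (s n * (\<theta> * x + \<bar>\<theta>\<bar> * d)) * indicator {\<omega>. \<bar>Y n \<omega> - x\<bar> < d} \<omega>"
    let ?b = "\<lambda>\<omega>. ?E \<omega> * indicator {\<omega>. h1 * (x + d) \<le> h1 * Y n \<omega>} \<omega>"
    let ?c = "\<lambda>\<omega>. ?E \<omega> * indicator {\<omega>. - h2 * (x - d) \<le> - h2 * Y n \<omega>} \<omega>"
    have ind: "integrable (M n) (\<lambda>\<omega>. ?E \<omega> * indicator {\<omega>. k \<le> l * Y n \<omega>} \<omega>)" for k l :: real
      by (rule Bochner_Integration.integrable_bound[OF integrable_exp[of n \<theta>]])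
         (auto simp: indicator_def)
    have ia: "integrable (M n) ?a"
      by (rule integrable_const_bound[where B = "exp (s n * (\<theta> * x + \<bar>\<theta>\<bar> * d))"]) (auto simp: indicator_def)
    have "mgf n \<theta> \<le> (\<integral>\<omega>. ?a \<omega> + ?b \<omega> + ?c \<omega> \<partial>M n)"
      unfolding mgf_def
    proof (rule integral_mono)
      show "integrable (M n) (\<lambda>\<omega>. ?a \<omega> + ?b \<omega> + ?c \<omega>)"
        by (intro Bochner_Integration.integrable_add ia ind)
      fix \<omega>
      consider "\<bar>Y n \<omega> - x\<bar> < d" | "x + d \<le> Y n \<omega>" | "Y n \<omega> \<le> x - d" by linarith
      then show "?E \<omega> \<le> ?a \<omega> + ?b \<omega> + ?c \<omega>"
      proof cases
        case 1
        have "\<theta> * Y n \<omega> = \<theta> * x + \<theta> * (Y n \<omega> - x)" by (simp add: algebra_simps)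
        also have "\<theta> * (Y n \<omega> - x) \<le> \<bar>\<theta>\<bar> * \<bar>Y n \<omega> - x\<bar>" by (metis abs_ge_self abs_mult)
        also have "\<dots> \<le> \<bar>\<theta>\<bar> * d" using 1 by (intro mult_left_mono) auto
        finally have "s n * (\<theta> * Y n \<omega>) \<le> s n * (\<theta> * x + \<bar>\<theta>\<bar> * d)" using elim by simp
        then have "?E \<omega> \<le> ?a \<omega>" using 1 by (simp add: mult_ac)
        moreover have "0 \<le> ?b \<omega>" "0 \<le> ?c \<omega>" by auto
        ultimately show ?thesis by linarith
      next
        case 2
        then have "?b \<omega> = ?E \<omega>" using h1 by simp
        moreover have "0 \<le> ?a \<omega>" "0 \<le> ?c \<omega>" by auto
        ultimately show ?thesis by linarith
      next
        case 3
        then have "?c \<omega> = ?E \<omega>" using h2 by simp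
        moreover have "0 \<le> ?a \<omega>" "0 \<le> ?b \<omega>" by auto
        ultimately show ?thesis by linarith
      qed
    qed (rule integrable_exp)
    also have "\<dots> = (\<integral>\<omega>. ?a \<omega> \<partial>M n) + (\<integral>\<omega>. ?b \<omega> \<partial>M n) + (\<integral>\<omega>. ?c \<omega> \<partial>M n)"
      by (simp only: Bochner_Integration.integral_add[OF Bochner_Integration.integrable_add[OF ia ind] ind]
          Bochner_Integration.integral_add[OF ia ind])
    also have "(\<integral>\<omega>. ?a \<omega> \<partial>M n) = exp (s n * (\<theta> * x + \<bar>\<theta>\<bar> * d)) * P"
      by (simp add: P_def Int_def conj_commute flip: integral_indicator)
    finally have main: "exp (s n * (\<Lambda> \<theta> - e)) - 2 * exp (s n * (\<Lambda> \<theta> - 3 * e))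
        \<le> exp (s n * (\<theta> * x + \<bar>\<theta>\<bar> * d)) * P" using elim by linarith
    \<comment> \<open>With t = exp(-s e) and in units of exp(s \<Lambda>(\<theta>)), the tails are at most 2 t^3 and the total at least t, which leaves t^2.\<close>
    define t where "t = exp (- (s n * e))"
    have t: "0 < t" "t \<le> 1 / 4"
    proof -
      have "ln 4 \<le> s n * e" using elim e by (simp add: field_simps)
      then have "t \<le> exp (- ln 4)" by (simp add: t_def)
      then show "t \<le> 1 / 4" by (simp add: exp_minus)
    qed (simp add: t_def)
    have "t * (t + 2 * t\<^sup>2) \<le> t * 1"
    proof (rule mult_left_mono)
      have "t * t \<le> 1/4 * (1/4)" using t by (intro mult_mono) auto
      then show "t + 2 * t\<^sup>2 \<le> 1" using t unfolding power2_eq_square by linarith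
    qed (use t in simp)
    then have "t ^ 2 \<le> t - 2 * t ^ 3" by (simp add: power2_eq_square power3_eq_cube algebra_simps)
    then have "exp (s n * \<Lambda> \<theta>) * t ^ 2 \<le> exp (s n * \<Lambda> \<theta>) * (t - 2 * t ^ 3)" by simp
    also have "\<dots> = exp (s n * (\<Lambda> \<theta> - e)) - 2 * exp (s n * (\<Lambda> \<theta> - 3 * e))"
      by (simp add: t_def right_diff_distrib mult_exp_exp algebra_simps flip: exp_of_nat_mult)
    also note main
    finally have "exp (- (s n * (\<theta> * x + \<bar>\<theta>\<bar> * d))) * (exp (s n * \<Lambda> \<theta>) * t ^ 2)
        \<le> exp (- (s n * (\<theta> * x + \<bar>\<theta>\<bar> * d))) * (exp (s n * (\<theta> * x + \<bar>\<theta>\<bar> * d)) * P)" by simp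
    also have "\<dots> = P" by (simp add: mult_exp_exp flip: mult.assoc)
    also have "exp (- (s n * (\<theta> * x + \<bar>\<theta>\<bar> * d))) * (exp (s n * \<Lambda> \<theta>) * t ^ 2)
        = exp (s n * (\<Lambda> \<theta> - \<theta> * x - \<bar>\<theta>\<bar> * d - 2 * e))"
      by (simp add: t_def mult_exp_exp algebra_simps flip: exp_of_nat_mult)
    finally have "exp (s n * (\<Lambda> \<theta> - \<theta> * x - \<bar>\<theta>\<bar> * d - 2 * e)) \<le> P" .
    moreover have "s n * (- c) \<le> s n * (\<Lambda> \<theta> - \<theta> * x - \<bar>\<theta>\<bar> * d - 2 * e)"
      using elim e d\<theta> by (intro mult_left_mono) (auto simp: g_def)
    ultimately have "exp (- (s n * c)) \<le> P" by (smt (verit) exp_le_cancel_iff mult_minus_right)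
    also have "P \<le> measure (M n) {\<omega> \<in> space (M n). \<bar>Y n \<omega> - x\<bar> < \<delta>}"
      unfolding P_def using d by (intro finite_measure_mono) auto
    finally show ?case .
  qed
qed

end

lemma eln_le: 
  assumes "p \<ge> 0" "p \<le> exp (- (s * c))" "s > 0"
  shows "ereal (1 / s) * eln p \<le> ereal (- c)"
proof (cases "p = 0")
  case True
  then show ?thesis using assms by (simp add: eln_def)
next
  case False
  then have "ln p \<le> - (s * c)" using assms by (metis exp_gt_zero less_eq_real_def ln_exp ln_le_cancel_iff)
  then show ?thesis using assms False by (simp add: eln_def field_simps)
qed

lemma eln_ge: 
  assumes "exp (- (s * c)) \<le> p" "s > 0"
  shows "ereal (- c) \<le> ereal (1 / s) * eln p"
proof -
  have p: "p > 0" using assms(1) by (smt (verit) exp_gt_zero)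
  then have "- (s * c) \<le> ln p" using assms by (metis exp_gt_zero ln_exp ln_le_cancel_iff)
  then show ?thesis using assms p by (simp add: eln_def field_simps)
qed

lemma ereal_le_uminusI:
  fixes a b :: ereal
  assumes "\<And>c. ereal c < a \<Longrightarrow> b \<le> ereal (- c)"
  shows "b \<le> - a"
proof (rule ccontr)
  assume "\<not> b \<le> - a"
  then have "- a < b" by simp
  from ereal_dense2[OF this] obtain r where r: "- a < ereal r" "ereal r < b" by blast
  then have "ereal (- r) < a" using ereal_uminus_less_reorder[of a "ereal r"] by simp
  from assms[OF this] r show False by simp
qed

text \<open>On the line a large deviation principle only has to be checked for half lines and for small
  intervals. If the closure of B avoids the zero m of I, then B is contained in the union of two half lines
  whose end points are the points of the closure next to m on either side, and the infimum of I over the closure is at most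
  the smaller of the two values there. Nonnegativity of I follows from the lower bound, as
  probabilities are at most 1.\<close>

lemma satisfies_LDP_from_tails:
  fixes M :: "nat \<Rightarrow> 'a measure" and Y :: "nat \<Rightarrow> 'a \<Rightarrow> real" and I :: "real \<Rightarrow> ereal"
  assumes prob: "\<And>n. prob_space (M n)"
    and rv [measurable]: "\<And>n. Y n \<in> borel_measurable (M n)"
    and s0: "\<And>n. 0 \<le> s n" and speed: "filterlim s at_top sequentially"
    and lsc: "lower_semicontinuous I" and cpt: "\<And>c. 0 \<le> c \<Longrightarrow> compact {x. I x \<le> ereal c}"
    and centre: "I m = 0"
    and upper: "\<And>b c. b > m \<Longrightarrow> ereal c < I b \<Longrightarrow>
        eventually (\<lambda>n. measure (M n) {\<omega> \<in> space (M n). b \<le> Y n \<omega>} \<le> exp (- (s n * c))) sequentially"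
    and lower: "\<And>a c. a < m \<Longrightarrow> ereal c < I a \<Longrightarrow>
        eventually (\<lambda>n. measure (M n) {\<omega> \<in> space (M n). Y n \<omega> \<le> a} \<le> exp (- (s n * c))) sequentially"
    and local: "\<And>x c \<delta>. I x < ereal c \<Longrightarrow> \<delta> > 0 \<Longrightarrow>
        eventually (\<lambda>n. exp (- (s n * c)) \<le> measure (M n) {\<omega> \<in> space (M n). \<bar>Y n \<omega> - x\<bar> < \<delta>}) sequentially"
  shows "satisfies_LDP M Y s I"
proof -
  have sp: "eventually (\<lambda>n. s n > 0) sequentially"
    using speed by (simp add: filterlim_at_top_dense)
  have le1: "measure (M n) A \<le> 1" for n A
    using prob_space.prob_le_1[OF prob] .
  have I_nonneg: "0 \<le> I x" for x
  proof (rule ccontr)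
    assume "\<not> 0 \<le> I x"
    then obtain c where c: "I x < ereal c" "ereal c < 0"
      using ereal_dense2[of "I x" 0] by (metis not_le)
    have "eventually (\<lambda>n. exp (- (s n * c)) \<le> measure (M n) {\<omega> \<in> space (M n). \<bar>Y n \<omega> - x\<bar> < 1}) sequentially"
      by (rule local[OF c(1)]) simp
    with sp have "eventually (\<lambda>n. False) sequentially"
    proof eventually_elim
      case (elim n)
      then have "exp (- (s n * c)) \<le> 1" using le1 order_trans by blast
      then show False using elim c by (simp add: zero_le_mult_iff)
    qed
    then show False by simp
  qed
  have "- (INF x \<in> interior B. I x) \<le> liminf (\<lambda>n. ereal (1 / s n) * eln (measure (M n) {\<omega> \<in> space (M n). Y n \<omega> \<in> B}))
      \<and> limsup (\<lambda>n. ereal (1 / s n) * eln (measure (M n) {\<omega> \<in> space (M n). Y n \<omega> \<in> B})) \<le> - (INF x \<in> closure B. I x)"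
    (is "_ \<le> liminf ?L \<and> _") if B [measurable]: "B \<in> sets borel" for B
  proof
    have [measurable]: "{\<omega> \<in> space (M n). Y n \<omega> \<in> B} \<in> sets (M n)" for n by measurable
    have "ereal (- c) \<le> liminf ?L" if x: "x \<in> interior B" and c: "I x < ereal c" for x c
    proof -
      obtain \<delta> where \<delta>: "\<delta> > 0" "ball x \<delta> \<subseteq> B" using x by (meson mem_interior)
      have "eventually (\<lambda>n. ereal (- c) \<le> ?L n) sequentially"
        using local[OF c \<delta>(1)] sp
      proof eventually_elim
        case (elim n)
        interpret prob_space "M n" by (rule prob)
        note elim(1)
        also have "measure (M n) {\<omega> \<in> space (M n). \<bar>Y n \<omega> - x\<bar> < \<delta>} \<le> measure (M n) {\<omega> \<in> space (M n). Y n \<omega> \<in> B}"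
          using \<delta>(2) by (intro finite_measure_mono) (auto simp: dist_real_def abs_minus_commute)
        finally show ?case using elim(2) by (rule eln_ge)
      qed
      then show ?thesis by (rule Liminf_bounded)
    qed
    then have "- liminf ?L \<le> I x" if "x \<in> interior B" for x
      using that by (metis (no_types, lifting) ereal_dense2 ereal_uminus_le_reorder leD leI uminus_ereal.simps(1))
    then have "- liminf ?L \<le> (INF x \<in> interior B. I x)" by (rule INF_greatest)
    then show "- (INF x \<in> interior B. I x) \<le> liminf ?L" by (simp add: ereal_uminus_le_reorder)
  next
    define C where "C = closure B"
    have "limsup ?L \<le> ereal (- c)" if c: "ereal c < (INF x \<in> C. I x)" for c
    proof (cases "c < 0")
      case True
      have "eventually (\<lambda>n. ?L n \<le> ereal (- c)) sequentially"
        using sp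
      proof eventually_elim
        case (elim n)
        have "exp 0 \<le> exp (- (s n * c))" using elim True by (simp add: mult_le_0_iff)
        then have "measure (M n) {\<omega> \<in> space (M n). Y n \<omega> \<in> B} \<le> exp (- (s n * c))"
          using le1[of n "{\<omega> \<in> space (M n). Y n \<omega> \<in> B}"] by (simp only: exp_zero)
        then show ?case using elim by (intro eln_le) auto
      qed
      then show ?thesis by (rule Limsup_bounded)
    next
      case False
      then obtain c' where c': "ereal c < ereal c'" "ereal c' < (INF x \<in> C. I x)"
        using ereal_dense2[OF c] by blast
      then have cc: "c < c'" "0 < c'" using False by auto
      have less: "ereal c' < I x" if "x \<in> C" for x using c'(2) that by (meson INF_lower less_le_trans)
      have "m \<notin> C" using less[of m] centre cc by auto
      have cl: "closed C" by (simp add: C_def)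
      have U: "eventually (\<lambda>n. measure (M n) {\<omega> \<in> space (M n). Y n \<omega> \<in> B \<and> m \<le> Y n \<omega>} \<le> exp (- (s n * c'))) sequentially"
      proof (cases "C \<inter> {m..} = {}")
        case True
        then have empty: "{\<omega> \<in> space (M n). Y n \<omega> \<in> B \<and> m \<le> Y n \<omega>} = {}" for n
          using closure_subset[of B] by (auto simp: C_def)
        show ?thesis unfolding empty by simp
      next
        case False
        define b where "b = Inf (C \<inter> {m..})"
        have bdd: "bdd_below (C \<inter> {m..})" by (auto intro!: bdd_belowI[of _ m])
        have b: "b \<in> C \<inter> {m..}" unfolding b_def
          by (rule closed_contains_Inf[OF False bdd]) (auto intro!: closed_Int cl)
        then have "b > m" using \<open>m \<notin> C\<close> by (cases "b = m") auto
        from upper[OF this less[of b]] b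
        have "eventually (\<lambda>n. measure (M n) {\<omega> \<in> space (M n). b \<le> Y n \<omega>} \<le> exp (- (s n * c'))) sequentially" by simp
        then show ?thesis
        proof eventually_elim
          case (elim n)
          interpret prob_space "M n" by (rule prob)
          have "measure (M n) {\<omega> \<in> space (M n). Y n \<omega> \<in> B \<and> m \<le> Y n \<omega>} \<le> measure (M n) {\<omega> \<in> space (M n). b \<le> Y n \<omega>}"
            using closure_subset[of B] bdd
            by (intro finite_measure_mono) (auto simp: b_def C_def intro!: cInf_lower)
          with elim show ?case by linarith
        qed
      qed
      have D: "eventually (\<lambda>n. measure (M n) {\<omega> \<in> space (M n). Y n \<omega> \<in> B \<and> Y n \<omega> \<le> m} \<le> exp (- (s n * c'))) sequentially"
      proof (cases "C \<inter> {..m} = {}")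
        case True
        then have empty: "{\<omega> \<in> space (M n). Y n \<omega> \<in> B \<and> Y n \<omega> \<le> m} = {}" for n
          using closure_subset[of B] by (auto simp: C_def)
        show ?thesis unfolding empty by simp
      next
        case False
        define a where "a = Sup (C \<inter> {..m})"
        have bdd: "bdd_above (C \<inter> {..m})" by (auto intro!: bdd_aboveI[of _ m])
        have a: "a \<in> C \<inter> {..m}" unfolding a_def
          by (rule closed_contains_Sup[OF False bdd]) (auto intro!: closed_Int cl)
        then have "a < m" using \<open>m \<notin> C\<close> by (cases "a = m") auto
        from lower[OF this less[of a]] a
        have "eventually (\<lambda>n. measure (M n) {\<omega> \<in> space (M n). Y n \<omega> \<le> a} \<le> exp (- (s n * c'))) sequentially" by simp
        then show ?thesis
        proof eventually_elim
          case (elim n)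
          interpret prob_space "M n" by (rule prob)
          have "measure (M n) {\<omega> \<in> space (M n). Y n \<omega> \<in> B \<and> Y n \<omega> \<le> m} \<le> measure (M n) {\<omega> \<in> space (M n). Y n \<omega> \<le> a}"
            using closure_subset[of B] bdd
            by (intro finite_measure_mono) (auto simp: a_def C_def intro!: cSup_upper)
          with elim show ?case by linarith
        qed
      qed
      have "eventually (\<lambda>n. s n \<ge> ln 2 / (c' - c)) sequentially"
        using speed by (simp add: filterlim_at_top)
      with U D sp have "eventually (\<lambda>n. ?L n \<le> ereal (- c)) sequentially"
      proof eventually_elim
        case (elim n)
        interpret prob_space "M n" by (rule prob)
        have "measure (M n) {\<omega> \<in> space (M n). Y n \<omega> \<in> B}
           \<le> measure (M n) ({\<omega> \<in> space (M n). Y n \<omega> \<in> B \<and> m \<le> Y n \<omega>} \<union> {\<omega> \<in> space (M n). Y n \<omega> \<in> B \<and> Y n \<omega> \<le> m})"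
          by (intro finite_measure_mono) auto
        also have "\<dots> \<le> measure (M n) {\<omega> \<in> space (M n). Y n \<omega> \<in> B \<and> m \<le> Y n \<omega>} + measure (M n) {\<omega> \<in> space (M n). Y n \<omega> \<in> B \<and> Y n \<omega> \<le> m}"
          by (intro measure_Un_le) auto
        also have "\<dots> \<le> 2 * exp (- (s n * c'))" using elim by linarith
        also have "\<dots> = exp (ln 2 - s n * c')" by (simp add: exp_diff exp_minus divide_inverse)
        also have "\<dots> \<le> exp (- (s n * c))"
        proof -
          have "ln 2 \<le> s n * (c' - c)" using elim cc by (simp add: field_simps)
          then show ?thesis by (simp add: algebra_simps)
        qed
        finally show ?case using elim by (intro eln_le) auto
      qed
      then show ?thesis by (rule Limsup_bounded)
    qed
    then show "limsup ?L \<le> - (INF x \<in> closure B. I x)"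
      unfolding C_def by (rule ereal_le_uminusI)
  qed
  moreover have "liminf f \<le> limsup f" for f :: "nat \<Rightarrow> ereal"
    by (rule Liminf_le_Limsup) simp
  ultimately show ?thesis
    unfolding satisfies_LDP_def good_rate_function_def Let_def
    using prob rv s0 speed I_nonneg lsc cpt by auto
qed

section \<open>The rate function\<close>

definition rate :: "real \<Rightarrow> real" where
  "rate x = x * ln (x / 2) + x * arsinh (2 * x) - x - 1 / 2 * sqrt (1 + 4 * x\<^sup>2) + 3 / 2"

lemma vertex_rate_eq: "vertex_rate x = (if x < 0 then \<infinity> else ereal (rate x))"
  by (simp add: vertex_rate_def rate_def)

lemma isCont_rate: "x > 0 \<Longrightarrow> isCont rate x"
  unfolding rate_def [abs_def]
  by (intro continuous_intros) (auto intro: add_nonneg_eq_0_iff)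

lemma rate_at_right_0: "(rate \<longlongrightarrow> rate 0) (at_right 0)"
  unfolding rate_def [abs_def] arsinh_real_def by real_asymp

lemma continuous_on_rate: "continuous_on {0..} rate"
  unfolding continuous_on_eq_continuous_within
proof
  fix x :: real assume "x \<in> {0..}"
  then consider "x = 0" | "x > 0" by force
  then show "continuous (at x within {0..}) rate"
  proof cases
    case 1
    then show ?thesis
      using rate_at_right_0 by (simp add: continuous_within at_within_Ici_at_right)
  next
    case 2
    then show ?thesis using isCont_rate continuous_at_imp_continuous_at_within by blast
  qed
qed

lemma rate_at_top: "filterlim rate at_top at_top"
  unfolding rate_def [abs_def] arsinh_real_def by real_asymp

lemma compact_vertex_rate_sublevel: "compact {x. vertex_rate x \<le> ereal c}"
proof -
  obtain K where K: "\<And>x. x \<ge> K \<Longrightarrow> rate x > c"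
    using rate_at_top by (auto simp: filterlim_at_top_dense eventually_at_top_linorder)
  have eq: "{x. vertex_rate x \<le> ereal c} = {x \<in> {0..max K 0}. rate x \<le> c}"
  proof (rule set_eqI)
    fix x
    show "x \<in> {x. vertex_rate x \<le> ereal c} \<longleftrightarrow> x \<in> {x \<in> {0..max K 0}. rate x \<le> c}"
      using K[of x] by (cases "x \<le> K") (auto simp: vertex_rate_eq)
  qed
  have "closed {x \<in> {0..max K 0}. rate x \<le> c}"
    by (intro continuous_on_closed_Collect_le continuous_on_const
          continuous_on_subset[OF continuous_on_rate]) auto
  moreover have "bounded {x \<in> {0..max K 0}. rate x \<le> c}"
    by (rule bounded_subset[of "{0..max K 0}"]) auto
  ultimately show ?thesis unfolding eq by (simp add: compact_eq_bounded_closed)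
qed

lemma lower_semicontinuous_vertex_rate: "lower_semicontinuous vertex_rate"
  unfolding lower_semicontinuous_def le_Liminf_iff
proof (intro allI impI)
  fix x :: real and y :: ereal
  assume y: "y < vertex_rate x"
  have right: "eventually (\<lambda>t. y < ereal (rate t)) F" if "(rate \<longlongrightarrow> rate x) F" "0 \<le> x" for F
    using that y by (intro order_tendstoD(1)[of _ "ereal (rate x)"]) (auto simp: vertex_rate_eq)
  consider "x < 0" | "x = 0" | "x > 0" by linarith
  then show "eventually (\<lambda>t. y < vertex_rate t) (at x)"
  proof cases
    case 1
    have "eventually (\<lambda>t. t < 0) (at x)" using 1 by (intro order_tendstoD(2)[OF tendsto_ident_at])
    then show ?thesis by eventually_elim (use y 1 in \<open>simp add: vertex_rate_eq\<close>)
  next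
    case 2
    have y': "y < \<infinity>" using y by auto
    have "eventually (\<lambda>t. y < vertex_rate t) (at_left 0)"
      by (rule eventually_mono[OF eventually_at_left_real[of "-1" 0]])
        (use y' in \<open>auto simp: vertex_rate_eq\<close>)
    moreover have "eventually (\<lambda>t. y < vertex_rate t) (at_right 0)"
    proof -
      have "eventually (\<lambda>t. y < ereal (rate t)) (at_right 0)"
        using right[of "at_right 0"] rate_at_right_0 2 by simp
      then show ?thesis
        using eventually_at_right_less[of "0::real"]
        by eventually_elim (simp add: vertex_rate_eq)
    qed
    ultimately show ?thesis unfolding 2 by (simp add: eventually_at_split)
  next
    case 3
    have "eventually (\<lambda>t. 0 < t) (at x)" using 3 by (intro order_tendstoD(1)[OF tendsto_ident_at])
    moreover have "eventually (\<lambda>t. y < ereal (rate t)) (at x)"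
      using right[OF isContD[OF isCont_rate[OF 3]]] 3 by simp
    ultimately show ?thesis by eventually_elim (simp add: vertex_rate_eq)
  qed
qed

text \<open>The derivative of the rate function at x > 0. As the inverse of the derivative of the limiting
  cumulant generating function it gives the tilt under which x becomes the mean.\<close>

definition tilt :: "real \<Rightarrow> real" where
  "tilt x = ln (x / 2) + arsinh (2 * x)"

lemma exp_tilt:
  assumes "x > 0"
  shows "exp (tilt x) = x / 2 * (2 * x + sqrt (1 + 4 * x\<^sup>2))"
proof -
  have "2 * x + sqrt (1 + 4 * x\<^sup>2) > 0" using assms by (intro add_pos_nonneg) auto
  then show ?thesis
    using assms by (simp add: tilt_def exp_add arsinh_real_def power_mult_distrib add_ac)
qed

lemma sqrt_tilt:
  assumes "x > 0"
  shows "sqrt (1 + 8 * exp (tilt x)) = 2 * x + sqrt (1 + 4 * x\<^sup>2)"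
proof (rule real_sqrt_unique)
  have "(sqrt (1 + 4 * x\<^sup>2))\<^sup>2 = 1 + 4 * x\<^sup>2" by simp
  then show "(2 * x + sqrt (1 + 4 * x\<^sup>2))\<^sup>2 = 1 + 8 * exp (tilt x)"
    unfolding exp_tilt[OF assms] by (simp add: power2_eq_square algebra_simps)
qed (use assms in simp)

text \<open>The rate function is the Legendre transform of the limiting cumulant generating function.\<close>

lemma rate_eq_tilt:
  assumes "x > 0"
  shows "rate x = tilt x * x - chain_exponent (exp (tilt x))"
  unfolding chain_exponent_def sqrt_tilt[OF assms] rate_def
  by (simp add: tilt_def field_simps)

lemma chain_exponent_deriv:
  assumes "x > 0"
  shows "((\<lambda>\<theta>. chain_exponent (exp \<theta>)) has_real_derivative x) (at (tilt x))"
proof -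
  have pos: "1 + 8 * exp (tilt x) > 0" by (simp add: add_pos_pos)
  let ?w = "2 * x + sqrt (1 + 4 * x\<^sup>2)"
  have w: "?w > 0" using assms by (intro add_pos_nonneg) auto
  have "((\<lambda>\<theta>. chain_exponent (exp \<theta>)) has_real_derivative
      (8 * exp (tilt x) * (inverse (sqrt (1 + 8 * exp (tilt x))) / 2)) / 2) (at (tilt x))"
    unfolding chain_exponent_def using pos by (auto intro!: derivative_eq_intros)
  also have "(8 * exp (tilt x) * (inverse (sqrt (1 + 8 * exp (tilt x))) / 2)) / 2 = x"
    unfolding sqrt_tilt[OF assms] unfolding exp_tilt[OF assms] using w by (simp add: field_simps)
  finally show ?thesis .
qed

lemma tilt_mono: "0 < x \<Longrightarrow> x \<le> y \<Longrightarrow> tilt x \<le> tilt y"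
  unfolding tilt_def using arsinh_real_strict_mono[of "2 * x" "2 * y"]
  by (intro add_mono) (auto simp: le_less)

lemma tilt_mean: "tilt (2 / 3) = 0"
proof -
  have "sqrt (1 + 4 * (2 / 3)\<^sup>2) = 5 / 3" by (rule real_sqrt_unique) (auto simp: power2_eq_square)
  then have "exp (tilt (2 / 3)) = 1" by (subst exp_tilt) simp_all
  then show ?thesis by simp
qed

lemma rate_mean: "rate (2 / 3) = 0"
  by (simp add: rate_eq_tilt tilt_mean chain_exponent_def)

text \<open>Positivity of Y takes the place of the Chernoff bound on left half lines that end at or below 0, where no
  finite tilt is optimal. The lower bound at 0 follows from those at small positive points because the
  rate function is continuous there from the right.\<close>

lemma vertex_LDP_from_log_mgf:
  fixes M :: "nat \<Rightarrow> 'a measure" and Y :: "nat \<Rightarrow> 'a \<Rightarrow> real"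
  assumes "log_mgf_limit M Y s (\<lambda>\<theta>. chain_exponent (exp \<theta>))"
    and s0: "\<And>n. 0 \<le> s n"
    and Y_pos: "eventually (\<lambda>n. \<forall>\<omega> \<in> space (M n). 0 < Y n \<omega>) sequentially"
  shows "satisfies_LDP M Y s vertex_rate"
proof -
  interpret log_mgf_limit M Y s "\<lambda>\<theta>. chain_exponent (exp \<theta>)" by fact
  show ?thesis
  proof (rule satisfies_LDP_from_tails[where m = "2 / 3", OF prob rv s0 speed
        lower_semicontinuous_vertex_rate compact_vertex_rate_sublevel])
    show "vertex_rate (2 / 3) = 0" by (simp add: vertex_rate_eq rate_mean)
  next
    fix b c :: real assume b: "2 / 3 < b" and c: "ereal c < vertex_rate b"
    have "0 \<le> tilt b" using tilt_mono[of "2/3" b] b by (simp add: tilt_mean)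
    have "c < tilt b * b - chain_exponent (exp (tilt b))"
      using c b by (simp add: vertex_rate_eq rate_eq_tilt)
    from chernoff[OF this]
    show "eventually (\<lambda>n. measure (M n) {\<omega> \<in> space (M n). b \<le> Y n \<omega>} \<le> exp (- (s n * c))) sequentially"
    proof eventually_elim
      case (elim n)
      interpret prob_space "M n" by (rule prob)
      have "measure (M n) {\<omega> \<in> space (M n). b \<le> Y n \<omega>}
          \<le> measure (M n) {\<omega> \<in> space (M n). tilt b * b \<le> tilt b * Y n \<omega>}"
        using \<open>0 \<le> tilt b\<close> by (intro finite_measure_mono) (auto intro: mult_left_mono)
      with elim show ?case by simp
    qed
  next
    fix a c :: real assume a: "a < 2 / 3" and c: "ereal c < vertex_rate a"
    show "eventually (\<lambda>n. measure (M n) {\<omega> \<in> space (M n). Y n \<omega> \<le> a} \<le> exp (- (s n * c))) sequentially"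
    proof (cases "a > 0")
      case True
      have "tilt a \<le> 0" using tilt_mono[OF True, of "2/3"] a by (simp add: tilt_mean)
      have "c < tilt a * a - chain_exponent (exp (tilt a))"
        using c True by (simp add: vertex_rate_eq rate_eq_tilt)
      from chernoff[OF this]
      show ?thesis
      proof eventually_elim
        case (elim n)
        interpret prob_space "M n" by (rule prob)
        have "measure (M n) {\<omega> \<in> space (M n). Y n \<omega> \<le> a}
            \<le> measure (M n) {\<omega> \<in> space (M n). tilt a * a \<le> tilt a * Y n \<omega>}"
          using \<open>tilt a \<le> 0\<close> by (intro finite_measure_mono) (auto intro: mult_left_mono_neg)
        with elim show ?case by simp
      qed
    next
      case False
      from Y_pos show ?thesis
      proof eventually_elim
        case (elim n)
        then have empty: "{\<omega> \<in> space (M n). Y n \<omega> \<le> a} = {}" using False by force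
        show ?case unfolding empty by simp
      qed
    qed
  next
    fix x c \<delta> :: real assume c: "vertex_rate x < ereal c" and \<delta>: "\<delta> > 0"
    have pos: "eventually (\<lambda>n. exp (- (s n * c)) \<le> measure (M n) {\<omega> \<in> space (M n). \<bar>Y n \<omega> - x\<bar> < \<delta>}) sequentially"
      if "x > 0" "rate x < c" "\<delta> > 0" for x \<delta>
      using local_lower_bound[OF chain_exponent_deriv[OF \<open>x > 0\<close>] _ \<open>\<delta> > 0\<close>, of c] that
      by (simp add: rate_eq_tilt)
    have x: "x \<ge> 0" "rate x < c" using c by (auto simp: vertex_rate_eq split: if_splits)
    show "eventually (\<lambda>n. exp (- (s n * c)) \<le> measure (M n) {\<omega> \<in> space (M n). \<bar>Y n \<omega> - x\<bar> < \<delta>}) sequentially"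
    proof (cases "x = 0")
      case False
      then show ?thesis using pos x \<delta> by simp
    next
      case True
      have "eventually (\<lambda>t. rate t < c) (at_right 0)"
        using order_tendstoD(2)[OF rate_at_right_0] x True by simp
      moreover have "eventually (\<lambda>t. t \<in> {0<..<\<delta> / 2}) (at_right 0)"
        using \<delta> by (intro eventually_at_right_real) simp
      ultimately have "eventually (\<lambda>t. rate t < c \<and> t \<in> {0<..<\<delta> / 2}) (at_right 0)"
        by (rule eventually_conj)
      then obtain t where t: "rate t < c" "0 < t" "t < \<delta> / 2"
        using eventually_happens'[OF trivial_limit_at_right_real] by auto
      have "\<delta> / 2 > 0" using \<delta> by simp
      from pos[OF t(2,1) this] show ?thesis
      proof eventually_elim
        case (elim n)
        interpret prob_space "M n" by (rule prob)
        have "measure (M n) {\<omega> \<in> space (M n). \<bar>Y n \<omega> - t\<bar> < \<delta> / 2}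
            \<le> measure (M n) {\<omega> \<in> space (M n). \<bar>Y n \<omega> - x\<bar> < \<delta>}"
        proof (rule finite_measure_mono)
          have "\<bar>y - x\<bar> < \<delta>" if "\<bar>y - t\<bar> < \<delta> / 2" for y using t True that by linarith
          then show "{\<omega> \<in> space (M n). \<bar>Y n \<omega> - t\<bar> < \<delta> / 2} \<subseteq> {\<omega> \<in> space (M n). \<bar>Y n \<omega> - x\<bar> < \<delta>}"
            by blast
        qed simp
        with elim show ?case by simp
      qed
    qed
  qed
qed

section \<open>The large deviation principle\<close>

lemma num_vertices_le_card:
  assumes "finite F"
  shows "num_vertices (convex hull F) \<le> card F"
  unfolding num_vertices_def by (rule card_mono[OF assms extreme_points_of_convex_hull])

lemma num_vertices_pos:
  fixes F :: "'a::euclidean_space set"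
  assumes "finite F" "F \<noteq> {}"
  shows "num_vertices (convex hull F) > 0"
proof -
  obtain v where "v extreme_point_of (convex hull F)"
    using extreme_point_exists_convex[of "convex hull F"] assms
    by (auto simp: finite_imp_compact_convex_hull)
  moreover have "finite {v. v extreme_point_of (convex hull F)}"
    by (rule finite_subset[OF extreme_points_of_convex_hull assms(1)])
  ultimately show ?thesis unfolding num_vertices_def by (auto simp: card_gt_0_iff)
qed

text \<open>Independence and the uniform law identify the joint law of the points with the product measure of the
  recursion.\<close>

lemma nn_integral_power_num_vertices:
  fixes X :: "nat \<Rightarrow> 'a \<Rightarrow> real \<times> real"
  assumes "prob_space N" and indep: "prob_space.indep_vars N (\<lambda>_. borel) X {1..n}"
    and law: "\<And>i. i \<in> {1..n} \<Longrightarrow> distr N borel (X i) = triangle_law"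
    and n: "n \<ge> 1" and z: "z \<ge> 0"
  shows "(\<integral>\<^sup>+\<omega>. ennreal (z ^ num_vertices (random_polygon (\<lambda>i. X i \<omega>) n)) \<partial>N)
       = ennreal (z\<^sup>2 * chain_gf z n)"
proof -
  interpret prob_space N by fact
  let ?I = "{1..n}"
  have rv: "X i \<in> borel_measurable N" if "i \<in> ?I" for i
    using indep that by (auto simp: indep_vars_def2)
  let ?g = "\<lambda>\<omega> :: nat \<Rightarrow> real \<times> real. ennreal (1 * z ^ num_vertices (convex hull ({(1, 0), (0, 1)} \<union> \<omega> ` ?I)))"
  have distr: "distr N (PiM ?I (\<lambda>_. borel)) (\<lambda>\<omega>. \<lambda>i\<in>?I. X i \<omega>) = points_law ?I"
  proof -
    have "distr N (PiM ?I (\<lambda>_. borel)) (\<lambda>\<omega>. \<lambda>i\<in>?I. X i \<omega>) = PiM ?I (\<lambda>i. distr N borel (X i))"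
      using indep_vars_iff_distr_eq_PiM'[where I = ?I and M' = "\<lambda>_. borel" and X = X] indep rv n by simp
    also have "\<dots> = points_law ?I" by (intro PiM_cong refl law)
    finally show ?thesis .
  qed
  have gm: "?g \<in> borel_measurable (PiM ?I (\<lambda>_. borel))"
    by (intro measurable_power_num_vertices) auto
  have "(\<integral>\<^sup>+\<omega>. ennreal (z ^ num_vertices (random_polygon (\<lambda>i. X i \<omega>) n)) \<partial>N)
      = (\<integral>\<^sup>+\<omega>. ?g (\<lambda>i\<in>?I. X i \<omega>) \<partial>N)"
    by (intro nn_integral_cong) (auto simp: random_polygon_def intro!: arg_cong[where f = "\<lambda>S. z ^ num_vertices (convex hull S)"])
  also have "\<dots> = (\<integral>\<^sup>+\<omega>. ?g \<omega> \<partial>points_law ?I)"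
    unfolding distr[symmetric]
    by (rule nn_integral_distr[symmetric, OF measurable_restrict[OF rv]])
      (simp_all only: measurable_distr_eq1 gm)
  also have "\<dots> = vertex_gf z ?I" unfolding vertex_gf_def by simp
  also have "\<dots> = ennreal (z\<^sup>2 * chain_gf z n)" using vertex_gf_eq[OF z, of ?I] by simp
  finally show ?thesis .
qed

theorem theorem3p8:
  fixes M :: "nat \<Rightarrow> 'a measure" and X :: "nat \<Rightarrow> nat \<Rightarrow> 'a \<Rightarrow> real \<times> real"
  assumes "\<And>n. prob_space (M n)"
    and "\<And>n. prob_space.indep_vars (M n) (\<lambda>_. borel) (X n) {1..n}"
    and "\<And>n i. i \<in> {1..n} \<Longrightarrow> distr (M n) borel (X n i) = uniform_measure lborel unit_triangle"
  shows "satisfies_LDP M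
           (\<lambda>n \<omega>. real (num_vertices (random_polygon (\<lambda>i. X n i \<omega>) n)) / ln (real n))
           (\<lambda>n. ln (real n)) vertex_rate"
proof -
  define V where "V n \<omega> = num_vertices (random_polygon (\<lambda>i. X n i \<omega>) n)" for n \<omega>
  define Y where "Y n \<omega> = real (V n \<omega>) / ln (real n)" for n \<omega>
  have rv: "X n i \<in> borel_measurable (M n)" if "i \<in> {1..n}" for n i
    using assms(2)[of n] that by (simp add: prob_space.indep_vars_def2[OF assms(1)])
  have V [measurable]: "V n \<in> measurable (M n) (count_space UNIV)" for n
    unfolding V_def random_polygon_def
    by (rule measurable_num_vertices_with_base) (auto intro: rv)
  have Ym [measurable]: "Y n \<in> borel_measurable (M n)" for n
    unfolding Y_def by measurable
  have card: "card ({(1, 0), (0, 1)} \<union> x ` {1..n}) \<le> n + 2" for x :: "nat \<Rightarrow> real \<times> real" and n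
    using card_Un_le[of "{(1, 0), (0, 1)}" "x ` {1..n}"] card_image_le[of "{1..n}" x] by simp
  have V_le: "V n \<omega> \<le> n + 2" for n \<omega>
    using num_vertices_le_card[of "{(1, 0), (0, 1)} \<union> (\<lambda>i. X n i \<omega>) ` {1..n}"] card[of "\<lambda>i. X n i \<omega>" n]
    by (simp add: V_def random_polygon_def)
  have V_pos: "V n \<omega> > 0" for n \<omega>
    unfolding V_def random_polygon_def by (rule num_vertices_pos) auto
  have speed: "filterlim (\<lambda>n. ln (real n)) at_top sequentially"
    by (intro filterlim_compose[OF ln_at_top] filterlim_real_sequentially)
  have sY: "ln (real n) * Y n \<omega> = real (V n \<omega>)" if "n \<ge> 2" for n \<omega>
    using that by (simp add: Y_def)
  \<comment> \<open>For n < 2 the speed is 0 and division by 0 gives 0, so that the bound below covers these n as well.\<close>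
  have int: "integrable (M n) (\<lambda>\<omega>. exp (\<theta> * (ln (real n) * Y n \<omega>)))" for n \<theta>
  proof -
    interpret prob_space "M n" by (rule assms(1))
    have "\<bar>ln (real n) * Y n \<omega>\<bar> \<le> real (n + 2)" for \<omega>
      using V_le[of n \<omega>] by (auto simp: Y_def)
    then have "\<bar>\<theta>\<bar> * \<bar>ln (real n) * Y n \<omega>\<bar> \<le> \<bar>\<theta>\<bar> * real (n + 2)" for \<omega>
      by (rule mult_left_mono) simp
    then have "\<theta> * (ln (real n) * Y n \<omega>) \<le> \<bar>\<theta>\<bar> * real (n + 2)" for \<omega>
      using order_trans[OF abs_ge_self[of "\<theta> * (ln (real n) * Y n \<omega>)"]] by (simp only: abs_mult)
    then show ?thesis
      by (intro integrable_const_bound[where B = "exp (\<bar>\<theta>\<bar> * real (n + 2))"]) auto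
  qed
  have mgf: "(\<integral>\<omega>. exp (\<theta> * (ln (real n) * Y n \<omega>)) \<partial>M n) = (exp \<theta>)\<^sup>2 * chain_gf (exp \<theta>) n"
    if n: "n \<ge> 2" for n \<theta>
  proof -
    have "(\<integral>\<omega>. exp (\<theta> * (ln (real n) * Y n \<omega>)) \<partial>M n) = (\<integral>\<omega>. exp \<theta> ^ V n \<omega> \<partial>M n)"
      unfolding sY[OF n] by (simp add: exp_of_nat2_mult)
    also have "\<dots> = enn2real (\<integral>\<^sup>+\<omega>. ennreal (exp \<theta> ^ V n \<omega>) \<partial>M n)"
      by (rule integral_eq_nn_integral) (auto simp: V)
    also have "(\<integral>\<^sup>+\<omega>. ennreal (exp \<theta> ^ V n \<omega>) \<partial>M n) = ennreal ((exp \<theta>)\<^sup>2 * chain_gf (exp \<theta>) n)"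
      unfolding V_def using n by (intro nn_integral_power_num_vertices assms) auto
    also have "enn2real \<dots> = (exp \<theta>)\<^sup>2 * chain_gf (exp \<theta>) n"
      using chain_gf_pos[of "exp \<theta>" n] by (simp add: less_imp_le)
    finally show ?thesis .
  qed
  have lim: "(\<lambda>n. ln (\<integral>\<omega>. exp (\<theta> * (ln (real n) * Y n \<omega>)) \<partial>M n) / ln (real n)) \<longlonglongrightarrow> chain_exponent (exp \<theta>)" for \<theta>
  proof -
    have "(\<lambda>n. 2 * \<theta> / ln (real n) + ln (chain_gf (exp \<theta>) n) / ln (real n)) \<longlonglongrightarrow> 0 + chain_exponent (exp \<theta>)"
      by (intro tendsto_add chain_gf_growth real_tendsto_divide_at_top[OF tendsto_const speed]) simp
    moreover have "eventually (\<lambda>n. ln (\<integral>\<omega>. exp (\<theta> * (ln (real n) * Y n \<omega>)) \<partial>M n) / ln (real n)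
        = 2 * \<theta> / ln (real n) + ln (chain_gf (exp \<theta>) n) / ln (real n)) sequentially"
      using eventually_ge_at_top[of 2]
    proof eventually_elim
      case (elim n)
      have "ln ((exp \<theta>)\<^sup>2 * chain_gf (exp \<theta>) n) = 2 * \<theta> + ln (chain_gf (exp \<theta>) n)"
        using chain_gf_pos[of "exp \<theta>" n] by (simp add: ln_mult_pos ln_realpow)
      then show ?case by (simp add: mgf[OF elim] add_divide_distrib)
    qed
    ultimately show ?thesis by (simp add: tendsto_cong)
  qed
  have "log_mgf_limit M Y (\<lambda>n. ln (real n)) (\<lambda>\<theta>. chain_exponent (exp \<theta>))"
    by (rule log_mgf_limit.intro[OF assms(1) Ym int speed lim])
  moreover have "0 \<le> ln (real n)" for n by (cases "n = 0") auto
  moreover have "eventually (\<lambda>n. \<forall>\<omega>\<in>space (M n). 0 < Y n \<omega>) sequentially"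
    using eventually_ge_at_top[of 2] by eventually_elim (simp add: Y_def V_pos)
  ultimately have "satisfies_LDP M Y (\<lambda>n. ln (real n)) vertex_rate"
    by (rule vertex_LDP_from_log_mgf)
  then show ?thesis unfolding Y_def [abs_def] V_def .
qed

end
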